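(* Suppose that $c_0/n\leq p\leq 1/2$ for some sufficiently large constant $c_0>0$. Then there exist constants $c_1,c_2,c_3,c_4>0$ such that with probability $1-o(1)$ as $n\to\infty$ $$c_1\sqrt{n/p}\leq\vartheta_{1/2}(G(n,p))\leq\vartheta(G(n,p))\leq\vartheta_2(G(n,p))\leq c_2\sqrt{n/p}$$ and $$c_3\sqrt{np}\leq\bar\vartheta_{1/2}(G(n,p))\leq\bar\vartheta(G(n,p))\leq\bar\vartheta_2(G(n,p))\leq c_4\sqrt{np}.$$ More precisely, $\Pr\big(c_3\sqrt{np}\leq\bar\vartheta_{1/2}(G(n,p))\leq\bar\vartheta(G(n,p))\leq\bar\vartheta_2(G(n,p))\big)\geq 1-\exp(-n)$.
   Context: $G(n,p)$ is the random graph on $V=\{1,\dots,n\}$ with each possible edge present independently with probability $p$. For a graph $G=(V,E)$ and a real $k>1$, an $n$-tuple $(v_1,\dots,v_n)$ of unit vectors in $\mathbb R^n$ is a vector $k$-coloring if $\langle v_i,v_j\rangle\leq-1/(k-1)$ for all $\{i,j\}\in E$; strict if $\langle v_i,v_j\rangle=-1/(k-1)$ for all $\{i,j\}\in E$; rigid if equality holds on all edges and $\langle v_i,v_j\rangle\geq-1/(k-1)$ for all non-adjacent $i\neq j$. $\bar\vartheta_{1/2}(G)$ (the vector chromatic number), $\bar\vartheta(G)$, $\bar\vartheta_2(G)$ denote the infimum of $k>1$ such that $G$ admits a vector, strict vector, resp. rigid vector $k$-coloring. With $\bar G$ the complement of $G$, $\vartheta_{1/2}(G)=\bar\vartheta_{1/2}(\bar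 G)$, $\vartheta(G)=\bar\vartheta(\bar G)$ (Lovász number), $\vartheta_2(G)=\bar\vartheta_2(\bar G)$. *)

theory Defs
  imports "HOL-Analysis.Analysis"
begin

text \<open>Graphs on the vertex set {0..<n} (a relabelling of {1,...,n}) are given by
  their edge sets: sets of 2-element subsets of {0..<n}.\<close>

definition all_pairs :: "nat \<Rightarrow> nat set set" where
  "all_pairs n = {e. \<exists>i j. i < j \<and> j < n \<and> e = {i, j}}"

definition compl_graph :: "nat \<Rightarrow> nat set set \<Rightarrow> nat set set" where
  "compl_graph n E = all_pairs n - E"

definition gnp_prob :: "nat \<Rightarrow> real \<Rightarrow> (nat set set \<Rightarrow> bool) \<Rightarrow> real" where
  "gnp_prob n p P = (\<Sum>E\<in>Pow (all_pairs n).
      if P E then p ^ card E * (1 - p) ^ (card (all_pairs n) - card E) else 0)"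

text \<open>Vectors in R^n are functions nat => real, only coordinates 0..<n matter.\<close>
definition ip :: "nat \<Rightarrow> (nat \<Rightarrow> real) \<Rightarrow> (nat \<Rightarrow> real) \<Rightarrow> real" where
  "ip n x y = (\<Sum>k<n. x k * y k)"

definition unit_tuple :: "nat \<Rightarrow> (nat \<Rightarrow> nat \<Rightarrow> real) \<Rightarrow> bool" where
  "unit_tuple n v \<longleftrightarrow> (\<forall>i<n. ip n (v i) (v i) = 1)"

definition vec_coloring :: "nat \<Rightarrow> nat set set \<Rightarrow> real \<Rightarrow> (nat \<Rightarrow> nat \<Rightarrow> real) \<Rightarrow> bool" where
  "vec_coloring n E k v \<longleftrightarrow> unit_tuple n v \<and>
     (\<forall>i<n. \<forall>j<n. {i, j} \<in> E \<longrightarrow> ip n (v i) (v j) \<le> - 1 / (k - 1))"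

definition strict_vec_coloring :: "nat \<Rightarrow> nat set set \<Rightarrow> real \<Rightarrow> (nat \<Rightarrow> nat \<Rightarrow> real) \<Rightarrow> bool" where
  "strict_vec_coloring n E k v \<longleftrightarrow> unit_tuple n v \<and>
     (\<forall>i<n. \<forall>j<n. {i, j} \<in> E \<longrightarrow> ip n (v i) (v j) = - 1 / (k - 1))"

definition rigid_vec_coloring :: "nat \<Rightarrow> nat set set \<Rightarrow> real \<Rightarrow> (nat \<Rightarrow> nat \<Rightarrow> real) \<Rightarrow> bool" where
  "rigid_vec_coloring n E k v \<longleftrightarrow> unit_tuple n v \<and>
     (\<forall>i<n. \<forall>j<n. {i, j} \<in> E \<longrightarrow> ip n (v i) (v j) = - 1 / (k - 1)) \<and>
     (\<forall>i<n. \<forall>j<n. i \<noteq> j \<and> {i, j} \<notin> E \<longrightarrow> ip n (v i) (v j) \<ge> - 1 / (k - 1))"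

definition theta_bar_half :: "nat \<Rightarrow> nat set set \<Rightarrow> real" where
  "theta_bar_half n E = Inf {k. k > 1 \<and> (\<exists>v. vec_coloring n E k v)}"

definition theta_bar :: "nat \<Rightarrow> nat set set \<Rightarrow> real" where
  "theta_bar n E = Inf {k. k > 1 \<and> (\<exists>v. strict_vec_coloring n E k v)}"

definition theta_bar_2 :: "nat \<Rightarrow> nat set set \<Rightarrow> real" where
  "theta_bar_2 n E = Inf {k. k > 1 \<and> (\<exists>v. rigid_vec_coloring n E k v)}"

definition theta_half :: "nat \<Rightarrow> nat set set \<Rightarrow> real" where
  "theta_half n E = theta_bar_half n (compl_graph n E)"

definition theta :: "nat \<Rightarrow> nat set set \<Rightarrow> real" where
  "theta n E = theta_bar n (compl_graph n E)"

definition theta_2 :: "nat \<Rightarrow> nat set set \<Rightarrow> real" where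
  "theta_2 n E = theta_bar_2 n (compl_graph n E)"

end

theory Submission
  imports Defs
begin

text \<open>With \<open>d = np\<close>, weak duality gives
  \<open>theta_bar_half E * theta_bar_2 (compl_graph n E) \<ge> n\<close>, so both lower bounds follow from the upper
  bounds on \<open>theta_2\<close> and \<open>theta_bar_2\<close>. By strong duality those ask for a bound on \<open>\<Sum>D\<^sub>i\<^sub>j / tr D\<close> over
  positive semidefinite \<open>D\<close> that are nonpositive on the edges, respectively on the non-edges.
  The at most \<open>n / sqrt d\<close> indices whose diagonal entry exceeds \<open>sqrt d\<close> times the average are split
  off. On the rest one needs \<open>\<Sum>(A\<^sub>i\<^sub>j - p) D\<^sub>i\<^sub>j = O(sqrt d * tr D)\<close>: for rank one \<open>D\<close> this
  is a Chernoff bound over integer vectors whose entries are so small that no heavy pairs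
  occur, and Grothendieck's rounding argument extends it to all \<open>D\<close>. The exceptional
  indices are harmless for \<open>theta_2\<close> by their number alone. For \<open>theta_bar_2\<close> they induce, with
  probability \<open>1 - O(1/n)\<close>, an \<open>O(sqrt d)\<close>-degenerate, hence \<open>O(sqrt d)\<close>-colourable graph.
  Only this last step fails to have exponentially small failure probability.\<close>

section \<open>The random graph\<close>

text \<open>The spectral norm of \<open>A - p(J - I)\<close> cannot be used: for bounded
  \<open>d\<close> the vertices of unbounded degree push it beyond every multiple of
  \<open>sqrt d\<close>. They matter only for test vectors concentrated on few coordinates, hence
  the cap on the entries. Among vectors of squared length at most \<open>n\<close>, those with
  squared entries at most \<open>sqrt d\<close> tolerate a Chernoff parameter of order
  \<open>1 / sqrt d\<close> while exponential moments stay quadratic. A cap on the diagonal of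
  \<open>D\<close> is not inherited by its eigenvectors, so \<open>D\<close> has no evident
  decomposition into capped rank one matrices; Grothendieck rounding takes the place of the spectral
  decomposition. Constants: the Chernoff threshold is 80, rounding costs 36, and 36 * 80 = 2880.
  Splitting off the exceptional indices doubles both contributions, so 2 * 2881 + 2 = 5764 for
  \<open>theta_2\<close> and 2 * 5761 + 2 * 9 = 11540 for \<open>theta_bar_2\<close>; weak duality
  makes the lower constants their reciprocals.\<close>

definition gnp_weight :: "nat \<Rightarrow> real \<Rightarrow> nat set set \<Rightarrow> real" where
  "gnp_weight n p E = p ^ card E * (1 - p) ^ (card (all_pairs n) - card E)"

lemma all_pairs_subset: "all_pairs n \<subseteq> Pow {..<n}"
  by (auto simp: all_pairs_def)

lemma finite_all_pairs [simp]: "finite (all_pairs n)"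
  by (rule finite_subset[OF all_pairs_subset]) simp

lemma in_all_pairs_iff: "{i, j} \<in> all_pairs n \<longleftrightarrow> i < n \<and> j < n \<and> i \<noteq> j"
proof
  assume "{i, j} \<in> all_pairs n"
  then obtain a b where "a < b" "b < n" "{i, j} = {a, b}"
    by (auto simp: all_pairs_def)
  then show "i < n \<and> j < n \<and> i \<noteq> j"
    by (auto simp: doubleton_eq_iff)
next
  assume *: "i < n \<and> j < n \<and> i \<noteq> j"
  then show "{i, j} \<in> all_pairs n"
  proof (cases "i < j")
    case True
    with * show ?thesis by (auto simp: all_pairs_def)
  next
    case False
    with * have "j < i" "{i, j} = {j, i}" by auto
    with * show ?thesis unfolding all_pairs_def by blast
  qed
qed

lemma all_pairs_Suc: "all_pairs (Suc n) = all_pairs n \<union> (\<lambda>i. {i, n}) ` {..<n}"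
  by (auto simp: all_pairs_def less_Suc_eq)

lemma sum_all_pairs:
  fixes f :: "nat set \<Rightarrow> real"
  shows "(\<Sum>i<n. \<Sum>j<n. if i \<noteq> j then f {i, j} else 0) = 2 * (\<Sum>e\<in>all_pairs n. f e)"
proof (induction n)
  case 0
  have "all_pairs 0 = {}" by (auto simp: all_pairs_def)
  then show ?case by simp
next
  case (Suc n)
  have disj: "all_pairs n \<inter> (\<lambda>i. {i, n}) ` {..<n} = {}"
    using all_pairs_subset[of n] by auto
  have inj: "inj_on (\<lambda>i. {i, n}) {..<n}"
    by (auto simp: inj_on_def doubleton_eq_iff)
  have "(\<Sum>e\<in>all_pairs (Suc n). f e) = (\<Sum>e\<in>all_pairs n. f e) + (\<Sum>i<n. f {i, n})"
    by (simp add: all_pairs_Suc sum.union_disjoint disj sum.reindex[OF inj])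
  moreover have "(\<Sum>i<n. if i \<noteq> n then f {i, n} else 0) = (\<Sum>i<n. f {i, n})"
    by (rule sum.cong) auto
  moreover have "(\<Sum>j<n. if n \<noteq> j then f {n, j} else 0) = (\<Sum>i<n. f {i, n})"
    by (rule sum.cong) (auto simp: insert_commute)
  ultimately show ?case using Suc by (simp add: sum.distrib)
qed

lemma gnp_prob_eq: "gnp_prob n p P = (\<Sum>E\<in>Pow (all_pairs n). if P E then gnp_weight n p E else 0)"
  unfolding gnp_prob_def gnp_weight_def ..

lemma gnp_weight_nonneg: "0 \<le> p \<Longrightarrow> p \<le> 1 \<Longrightarrow> 0 \<le> gnp_weight n p E"
  unfolding gnp_weight_def by simp

text \<open>Independence of the edges in algebraic form: expanding the product on the right by
  \<open>prod_add\<close> lists all edge sets with their weights. The total weight and all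
  exponential moments below are instances.\<close>

lemma gnp_expectation_prod:
  "(\<Sum>E\<in>Pow (all_pairs n). gnp_weight n p E * (\<Prod>e\<in>E. f e) * (\<Prod>e\<in>all_pairs n - E. g e))
     = (\<Prod>e\<in>all_pairs n. p * f e + (1 - p) * g e)"
proof -
  have "(\<Prod>e\<in>all_pairs n. p * f e + (1 - p) * g e)
      = (\<Sum>E\<in>Pow (all_pairs n). (\<Prod>e\<in>E. p * f e) * (\<Prod>e\<in>all_pairs n - E. (1 - p) * g e))"
    by (rule prod_add) simp
  also have "\<dots> = (\<Sum>E\<in>Pow (all_pairs n).
      gnp_weight n p E * (\<Prod>e\<in>E. f e) * (\<Prod>e\<in>all_pairs n - E. g e))"
  proof (rule sum.cong[OF refl])
    fix E assume "E \<in> Pow (all_pairs n)"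
    then have "card (all_pairs n - E) = card (all_pairs n) - card E"
      by (intro card_Diff_subset) (auto intro: finite_subset)
    then show "(\<Prod>e\<in>E. p * f e) * (\<Prod>e\<in>all_pairs n - E. (1 - p) * g e)
        = gnp_weight n p E * (\<Prod>e\<in>E. f e) * (\<Prod>e\<in>all_pairs n - E. g e)"
      by (simp add: prod.distrib gnp_weight_def)
  qed
  finally show ?thesis ..
qed

lemma gnp_weight_total: "(\<Sum>E\<in>Pow (all_pairs n). gnp_weight n p E) = 1"
  using gnp_expectation_prod[of n p "\<lambda>_. 1" "\<lambda>_. 1"] by simp

lemma gnp_prob_mono:
  assumes "0 \<le> p" "p \<le> 1" and "\<And>E. E \<subseteq> all_pairs n \<Longrightarrow> P E \<Longrightarrow> Q E"
  shows "gnp_prob n p P \<le> gnp_prob n p Q"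
  unfolding gnp_prob_eq using assms by (intro sum_mono) (auto simp: gnp_weight_nonneg)

lemma gnp_prob_le_1:
  assumes "0 \<le> p" "p \<le> 1"
  shows "gnp_prob n p P \<le> 1"
  using gnp_prob_mono[OF assms, of n P "\<lambda>_. True"] by (simp add: gnp_prob_eq gnp_weight_total)

lemma gnp_prob_not: "gnp_prob n p (\<lambda>E. \<not> P E) = 1 - gnp_prob n p P"
proof -
  have "gnp_prob n p (\<lambda>E. \<not> P E) + gnp_prob n p P = (\<Sum>E\<in>Pow (all_pairs n). gnp_weight n p E)"
    unfolding gnp_prob_eq sum.distrib[symmetric] by (rule sum.cong) auto
  then show ?thesis by (simp add: gnp_weight_total)
qed

lemma gnp_prob_disj:
  assumes "0 \<le> p" "p \<le> 1"
  shows "gnp_prob n p (\<lambda>E. P E \<or> Q E) \<le> gnp_prob n p P + gnp_prob n p Q"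
  unfolding gnp_prob_eq sum.distrib[symmetric]
  using assms by (intro sum_mono) (auto simp: gnp_weight_nonneg)

lemma gnp_prob_union_bound:
  assumes "0 \<le> p" "p \<le> 1" "finite I"
  shows "gnp_prob n p (\<lambda>E. \<exists>x\<in>I. P x E) \<le> (\<Sum>x\<in>I. gnp_prob n p (P x))"
  using \<open>finite I\<close>
proof (induction I)
  case empty
  show ?case by (simp add: gnp_prob_eq)
next
  case (insert x I)
  have "gnp_prob n p (\<lambda>E. \<exists>y\<in>insert x I. P y E)
      = gnp_prob n p (\<lambda>E. P x E \<or> (\<exists>y\<in>I. P y E))"
    by simp
  also have "\<dots> \<le> gnp_prob n p (P x) + gnp_prob n p (\<lambda>E. \<exists>y\<in>I. P y E)"
    by (rule gnp_prob_disj[OF assms(1,2)])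
  finally show ?case using insert by simp
qed

lemma gnp_prob_markov:
  assumes "0 \<le> p" "p \<le> 1"
    and "\<And>E. E \<subseteq> all_pairs n \<Longrightarrow> 0 \<le> X E" and "\<And>E. E \<subseteq> all_pairs n \<Longrightarrow> P E \<Longrightarrow> 1 \<le> X E"
  shows "gnp_prob n p P \<le> (\<Sum>E\<in>Pow (all_pairs n). gnp_weight n p E * X E)"
  unfolding gnp_prob_eq
proof (rule sum_mono)
  fix E assume "E \<in> Pow (all_pairs n)"
  then have E: "E \<subseteq> all_pairs n" by simp
  have w: "0 \<le> gnp_weight n p E" using assms(1,2) by (rule gnp_weight_nonneg)
  show "(if P E then gnp_weight n p E else 0) \<le> gnp_weight n p E * X E"
    using assms(3)[OF E] assms(4)[OF E] w mult_left_mono[of 1 "X E" "gnp_weight n p E"] by auto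
qed

section \<open>Exponential moments of centred edge sums\<close>

lemma exp_le_quadratic:
  fixes c :: real
  assumes "\<bar>c\<bar> \<le> 1"
  shows "exp c \<le> 1 + c + c\<^sup>2"
proof (cases "c \<ge> 0")
  case True
  then show ?thesis using assms exp_bound[of c] by simp
next
  case False
  define x where "x = - c"
  have x: "0 < x" "x \<le> 1" using False assms by (auto simp: x_def)
  \<comment> \<open>The product equals 1 + x^3.\<close>
  have "1 \<le> (1 + x) * (1 - x + x\<^sup>2)"
    using x by (simp add: algebra_simps power2_eq_square)
  also have "\<dots> \<le> exp x * (1 - x + x\<^sup>2)"
    using x exp_ge_add_one_self[of x] by (intro mult_right_mono) (auto simp: add_nonneg_nonneg)
  finally have "exp (-x) \<le> 1 - x + x\<^sup>2"
    by (simp add: exp_minus field_simps)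
  then show ?thesis by (simp add: x_def)
qed

text \<open>A single centred indicator contributes at most \<open>exp (p * (exp c - 1 - c))\<close>,
  and \<open>exp_le_quadratic\<close> bounds the exponent by \<open>p * c^2\<close>. The factor
  \<open>p\<close>, the order of the variance, is what makes the bound strong enough for sparse
  graphs.\<close>

lemma gnp_mgf:
  assumes "0 \<le> p" "p \<le> 1" and c: "\<And>e. e \<in> all_pairs n \<Longrightarrow> \<bar>c e\<bar> \<le> 1"
  shows "(\<Sum>E\<in>Pow (all_pairs n). gnp_weight n p E * exp (\<Sum>e\<in>all_pairs n. (of_bool (e \<in> E) - p) * c e))
     \<le> exp (p * (\<Sum>e\<in>all_pairs n. (c e)\<^sup>2))"
proof -
  have "(\<Sum>E\<in>Pow (all_pairs n). gnp_weight n p E * exp (\<Sum>e\<in>all_pairs n. (of_bool (e \<in> E) - p) * c e))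
     = (\<Sum>E\<in>Pow (all_pairs n). gnp_weight n p E * (\<Prod>e\<in>E. exp ((1 - p) * c e)) *
          (\<Prod>e\<in>all_pairs n - E. exp (- p * c e)))"
  proof (rule sum.cong[OF refl])
    fix E assume "E \<in> Pow (all_pairs n)"
    then have E: "E \<subseteq> all_pairs n" "finite E" by (auto intro: finite_subset)
    have "(\<Sum>e\<in>all_pairs n. (of_bool (e \<in> E) - p) * c e)
      = (\<Sum>e\<in>all_pairs n - E. (of_bool (e \<in> E) - p) * c e) + (\<Sum>e\<in>E. (of_bool (e \<in> E) - p) * c e)"
      by (rule sum.subset_diff) (use E in auto)
    also have "\<dots> = (\<Sum>e\<in>all_pairs n - E. - p * c e) + (\<Sum>e\<in>E. (1 - p) * c e)"
      by (intro arg_cong2[where f = "(+)"] sum.cong) auto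
    finally show "gnp_weight n p E * exp (\<Sum>e\<in>all_pairs n. (of_bool (e \<in> E) - p) * c e)
        = gnp_weight n p E * (\<Prod>e\<in>E. exp ((1 - p) * c e)) *
          (\<Prod>e\<in>all_pairs n - E. exp (- p * c e))"
      using E by (simp add: exp_add exp_sum)
  qed
  also have "\<dots> = (\<Prod>e\<in>all_pairs n. p * exp ((1 - p) * c e) + (1 - p) * exp (- p * c e))"
    by (rule gnp_expectation_prod)
  also have "\<dots> \<le> (\<Prod>e\<in>all_pairs n. exp (p * (c e)\<^sup>2))"
  proof (rule prod_mono, intro conjI)
    fix e assume e: "e \<in> all_pairs n"
    show "0 \<le> p * exp ((1 - p) * c e) + (1 - p) * exp (- p * c e)"
      using assms(1,2) by simp
    have "p * exp ((1 - p) * c e) + (1 - p) * exp (- p * c e)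
        = exp (- p * c e) * (1 + p * (exp (c e) - 1))"
      by (simp add: algebra_simps exp_add[symmetric] mult.commute)
    also have "\<dots> \<le> exp (- p * c e) * exp (p * (exp (c e) - 1))"
      by (intro mult_left_mono) (use exp_ge_add_one_self in auto)
    also have "\<dots> = exp (p * (exp (c e) - 1 - c e))"
      by (simp add: exp_add[symmetric] algebra_simps)
    also have "\<dots> \<le> exp (p * (c e)\<^sup>2)"
      using exp_le_quadratic[OF c[OF e]] assms(1) by (simp add: mult_left_mono)
    finally show "p * exp ((1 - p) * c e) + (1 - p) * exp (- p * c e) \<le> exp (p * (c e)\<^sup>2)" .
  qed
  also have "\<dots> = exp (p * (\<Sum>e\<in>all_pairs n. (c e)\<^sup>2))"
    by (simp add: exp_sum sum_distrib_left)
  finally show ?thesis .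
qed

section \<open>Semidefinite duality\<close>

definition psd :: "nat \<Rightarrow> (nat \<Rightarrow> nat \<Rightarrow> real) \<Rightarrow> bool" where
  "psd n G \<longleftrightarrow> (\<forall>i<n. \<forall>j<n. G i j = G j i) \<and>
     (\<forall>z. 0 \<le> (\<Sum>i<n. \<Sum>j<n. z i * z j * G i j))"

lemma psd_sym: "psd n G \<Longrightarrow> i < n \<Longrightarrow> j < n \<Longrightarrow> G i j = G j i"
  by (auto simp: psd_def)

lemma psd_quad: "psd n G \<Longrightarrow> 0 \<le> (\<Sum>i<n. \<Sum>j<n. z i * z j * G i j)"
  by (auto simp: psd_def)

lemma psd_cong:
  assumes "\<And>i j. i < n \<Longrightarrow> j < n \<Longrightarrow> G i j = H i j"
  shows "psd n G = psd n H"
proof -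
  have "(\<Sum>i<n. \<Sum>j<n. z i * z j * G i j) = (\<Sum>i<n. \<Sum>j<n. z i * z j * H i j)" for z
    by (intro sum.cong refl) (simp add: assms)
  with assms show ?thesis by (simp add: psd_def)
qed

text \<open>The index set \<open>K\<close> is of any type: below it ranges over coordinates, pairs
  of coordinates and sign patterns.\<close>

lemma psd_gram:
  assumes "\<And>i j. i < n \<Longrightarrow> j < n \<Longrightarrow> G i j = (\<Sum>k\<in>K. x i k * x j k)"
  shows "psd n G"
  unfolding psd_def
proof (intro conjI allI impI)
  show "G i j = G j i" if "i < n" "j < n" for i j
    using that by (simp add: assms mult.commute)
  fix z :: "nat \<Rightarrow> real"
  have "(\<Sum>i<n. \<Sum>j<n. z i * z j * G i j) = (\<Sum>i<n. \<Sum>j<n. \<Sum>k\<in>K. (z i * x i k) * (z j * x j k))"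
    by (intro sum.cong refl) (auto simp: assms sum_distrib_left ac_simps)
  also have "\<dots> = (\<Sum>i<n. \<Sum>k\<in>K. \<Sum>j<n. (z i * x i k) * (z j * x j k))"
    by (intro sum.cong refl sum.swap)
  also have "\<dots> = (\<Sum>k\<in>K. \<Sum>i<n. \<Sum>j<n. (z i * x i k) * (z j * x j k))"
    by (rule sum.swap)
  also have "\<dots> = (\<Sum>k\<in>K. (\<Sum>i<n. z i * x i k)\<^sup>2)"
    by (simp add: power2_eq_square sum_product)
  finally show "0 \<le> (\<Sum>i<n. \<Sum>j<n. z i * z j * G i j)"
    by (simp add: sum_nonneg)
qed

lemma quad_form_Suc:
  fixes G :: "nat \<Rightarrow> nat \<Rightarrow> real"
  assumes "\<And>i. i < n \<Longrightarrow> G n i = G i n"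
  shows "(\<Sum>i<Suc n. \<Sum>j<Suc n. z i * z j * G i j)
    = (\<Sum>i<n. \<Sum>j<n. z i * z j * G i j) + 2 * z n * (\<Sum>i<n. z i * G i n) + (z n)\<^sup>2 * G n n"
proof -
  have "(\<Sum>j<n. z n * z j * G n j) = z n * (\<Sum>i<n. z i * G i n)"
    by (simp add: sum_distrib_left assms mult.assoc)
  moreover have "(\<Sum>i<n. z i * z n * G i n) = z n * (\<Sum>i<n. z i * G i n)"
    by (simp add: sum_distrib_left ac_simps)
  ultimately show ?thesis
    by (simp add: sum.distrib power2_eq_square)
qed

text \<open>Congruence by a diagonal matrix. An indicator \<open>c\<close> cuts out a principal
  submatrix padded with zeros; a constant \<open>c\<close> rescales \<open>G\<close>.\<close>

lemma psd_restrict: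
  assumes "psd n G"
  shows "psd n (\<lambda>i j. c i * c j * G i j)"
  unfolding psd_def
proof (intro conjI allI impI)
  show "c i * c j * G i j = c j * c i * G j i" if "i < n" "j < n" for i j
    using psd_sym[OF assms that] by simp
  show "0 \<le> (\<Sum>i<n. \<Sum>j<n. z i * z j * (c i * c j * G i j))" for z
    using psd_quad[OF assms, of "\<lambda>i. z i * c i"] by (simp add: ac_simps)
qed

lemma sum_of_bool_single:
  fixes f :: "nat \<Rightarrow> real"
  shows "i < n \<Longrightarrow> (\<Sum>k<n. of_bool (k = i) * f k) = f i"
  by (simp add: of_bool_def if_distrib[of "\<lambda>x. x * _"] sum.delta cong: if_cong)

lemma psd_pair:
  assumes G: "psd n G" and "i < n" "j < n"
  shows "0 \<le> a\<^sup>2 * G i i + 2 * a * b * G i j + b\<^sup>2 * G j j"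
proof -
  define z where "z = (\<lambda>k. a * of_bool (k = i) + b * (of_bool (k = j) :: real))"
  have s: "(\<Sum>k<n. z k * f k) = a * f i + b * f j" for f
  proof -
    have "(\<Sum>k<n. z k * f k) = a * (\<Sum>k<n. of_bool (k = i) * f k) + b * (\<Sum>k<n. of_bool (k = j) * f k)"
      by (simp only: z_def distrib_right sum.distrib sum_distrib_left mult.assoc)
    then show ?thesis using assms by (simp only: sum_of_bool_single)
  qed
  have "(\<Sum>k<n. \<Sum>l<n. z k * z l * G k l) = (\<Sum>k<n. z k * (\<Sum>l<n. z l * G k l))"
    by (simp add: sum_distrib_left mult.assoc)
  also have "\<dots> = a * (a * G i i + b * G i j) + b * (a * G j i + b * G j j)"
    by (simp only: s)
  finally show ?thesis
    using psd_quad[OF G, of z] psd_sym[OF G assms(2,3)] by (simp add: algebra_simps power2_eq_square)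
qed

lemma psd_diag_nonneg: "psd n G \<Longrightarrow> i < n \<Longrightarrow> 0 \<le> G i i"
  using psd_pair[of n G i i 1 0] by simp

lemma psd_entry_bound:
  assumes "psd n G" "i < n" "j < n"
  shows "\<bar>G i j\<bar> \<le> (G i i + G j j) / 2"
  using psd_pair[OF assms, of 1 1] psd_pair[OF assms, of 1 "-1"] by simp

text \<open>Cholesky factorisation: the Schur complement of the last pivot is factored in one
  dimension less, and one new coordinate restores the last row and column. Hence \<open>n\<close>
  coordinates suffice, as the definition of colourings demands.\<close>

lemma psd_gram_ex:
  assumes "psd n G"
  shows "\<exists>v. \<forall>i<n. \<forall>j<n. ip n (v i) (v j) = G i j"
  using assms
proof (induction n arbitrary: G)
  case 0
  show ?case by simp
next
  case (Suc n)
  define c where "c = G n n"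
  have sym: "\<And>i. i < n \<Longrightarrow> G n i = G i n" using psd_sym[OF Suc.prems] by simp
  have c: "0 \<le> c" unfolding c_def by (rule psd_diag_nonneg[OF Suc.prems]) simp
  have zero: "G i n = 0" if "c = 0" "i < n" for i
  proof (rule ccontr)
    assume "G i n \<noteq> 0"
    \<comment> \<open>A zero pivot forces a zero column: otherwise the form would be -1 at this
      vector supported on \<open>i\<close> and \<open>n\<close>.\<close>
    then have "1 * G i i + 2 * 1 * (- (G i i + 1) / (2 * G i n)) * G i n = -1"
      by (simp add: field_simps)
    moreover have "0 \<le> 1\<^sup>2 * G i i + 2 * 1 * (- (G i i + 1) / (2 * G i n)) * G i n
        + (- (G i i + 1) / (2 * G i n))\<^sup>2 * G n n"
      using that by (intro psd_pair[OF Suc.prems]) auto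
    ultimately show False using that by (simp add: c_def)
  qed
  \<comment> \<open>For \<open>c = 0\<close> the quotient is 0 by convention, which is correct since
    the column vanishes.\<close>
  define G' where "G' = (\<lambda>i j. G i j - G i n * G j n / c)"
  have "psd n G'"
    unfolding psd_def
  proof (intro conjI allI impI)
    show "G' i j = G' j i" if "i < n" "j < n" for i j
      using psd_sym[OF Suc.prems, of i j] that by (simp add: G'_def)
    fix z :: "nat \<Rightarrow> real"
    define S where "S = (\<Sum>i<n. z i * G i n)"
    \<comment> \<open>Completing the square: this last coordinate minimises the form of
      \<open>G\<close>, and the minimum is the form of \<open>G'\<close>.\<close>
    define z' where "z' = z(n := - S / c)"
    have "(\<Sum>i<n. \<Sum>j<n. z i * z j * G' i j)
        = (\<Sum>i<n. \<Sum>j<n. z i * z j * G i j) - (\<Sum>i<n. \<Sum>j<n. (z i * G i n) * (z j * G j n)) / c"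
      by (simp add: G'_def right_diff_distrib sum_subtractf sum_divide_distrib ac_simps)
    also have "\<dots> = (\<Sum>i<n. \<Sum>j<n. z i * z j * G i j) - S\<^sup>2 / c"
      by (simp add: S_def power2_eq_square sum_product)
    also have "\<dots> = (\<Sum>i<n. \<Sum>j<n. z i * z j * G i j) + 2 * (- S / c) * S + (- S / c)\<^sup>2 * c"
      by (cases "c = 0") (simp_all add: field_simps power2_eq_square)
    also have "\<dots> = (\<Sum>i<Suc n. \<Sum>j<Suc n. z' i * z' j * G i j)"
      proof -
      have "z' i = z i" if "i < n" for i using that by (simp add: z'_def)
      then have "(\<Sum>i<n. \<Sum>j<n. z' i * z' j * G i j) = (\<Sum>i<n. \<Sum>j<n. z i * z j * G i j)"
        "(\<Sum>i<n. z' i * G i n) = S"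
        by (simp_all add: S_def)
      moreover have "z' n = - S / c" by (simp add: z'_def)
      ultimately show ?thesis
        by (simp only: quad_form_Suc[of n G, OF sym] c_def)
    qed
    finally show "0 \<le> (\<Sum>i<n. \<Sum>j<n. z i * z j * G' i j)"
      using psd_quad[OF Suc.prems] by simp
  qed
  then obtain v where v: "\<And>i j. i < n \<Longrightarrow> j < n \<Longrightarrow> ip n (v i) (v j) = G' i j"
    using Suc.IH by blast
  define w where "w = (\<lambda>i k. if i < n then (if k < n then v i k else G i n / sqrt c)
      else if k < n then 0 else sqrt c)"
  have "ip (Suc n) (w i) (w j) = G i j" if ij: "i < Suc n" "j < Suc n" for i j
  proof -
    have s: "ip (Suc n) (w i) (w j) = ip n (w i) (w j) + w i n * w j n"
      by (simp add: ip_def)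
    consider "i < n" "j < n" | "i < n" "j = n" | "i = n" "j < n" | "i = n" "j = n"
      using ij unfolding less_Suc_eq by blast
    then show ?thesis
    proof cases
      case 1
      then have "ip n (w i) (w j) = G' i j" using v[of i j] by (simp add: ip_def w_def)
      with 1 s c show ?thesis by (simp add: w_def G'_def)
    next
      case 2
      then have "ip n (w i) (w j) = 0" by (simp add: ip_def w_def)
      with 2 s c zero show ?thesis by (simp add: w_def)
    next
      case 3
      then have "ip n (w i) (w j) = 0" by (simp add: ip_def w_def)
      with 3 s c zero sym show ?thesis by (simp add: w_def)
    next
      case 4
      then have "ip n (w i) (w j) = 0" by (simp add: ip_def w_def)
      with 4 s c show ?thesis by (simp add: w_def c_def)
    qed
  qed
  then show ?case by blast
qed

section \<open>Strong duality by a least squares projection\<close>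

lemma first_order_nonneg:
  fixes a b :: real
  assumes "\<And>t. 0 < t \<Longrightarrow> t < 1 \<Longrightarrow> 0 \<le> 2 * t * a + t\<^sup>2 * b" and "0 \<le> b"
  shows "0 \<le> a"
proof (rule ccontr)
  assume a: "\<not> 0 \<le> a"
  \<comment> \<open>Small enough that \<open>t * b\<close> cannot outweigh \<open>- a\<close>; the
    summand 1 covers \<open>b = 0\<close>.\<close>
  define t where "t = min (1/2) (- a / (b + 1))"
  have "t \<le> 1/2" unfolding t_def by (rule min.cobounded1)
  then have t: "0 < t" "t < 1" using a assms(2) by (auto simp: t_def divide_neg_pos)
  have "t * b \<le> - a / (b + 1) * b" using assms(2) by (intro mult_right_mono) (auto simp: t_def)
  also have "\<dots> \<le> - a" using a assms(2) by (simp add: field_simps)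
  finally have "2 * a + t * b < 0" using a by simp
  then have "t * (2 * a + t * b) < 0" using t by (simp add: mult_less_0_iff)
  then show False using assms(1)[OF t] by (simp add: algebra_simps power2_eq_square)
qed

text \<open>Tychonoff's theorem. Matrices are functions on all pairs of naturals, so the minimiser
  is sought in an infinite product.\<close>

lemma compact_box_fun: "compact {P :: 'a \<Rightarrow> real. \<forall>i. \<bar>P i\<bar> \<le> B}"
proof -
  have "compactin (product_topology (\<lambda>_. euclidean) UNIV) (PiE UNIV (\<lambda>_::'a. {-B..B}))"
    unfolding compactin_PiE by simp
  then have "compact (PiE UNIV (\<lambda>_::'a. {-B..B}))"
    by (simp add: euclidean_product_topology)
  moreover have "PiE UNIV (\<lambda>_::'a. {-B..B}) = {P. \<forall>i. \<bar>P i\<bar> \<le> B}"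
    by (auto simp: PiE_UNIV_domain abs_le_iff Pi_def minus_le_iff)
  ultimately show ?thesis by simp
qed

lemma closed_psd: "closed {P :: nat \<times> nat \<Rightarrow> real. psd n (curry P)}"
proof -
  have "{P :: nat \<times> nat \<Rightarrow> real. psd n (curry P)} =
      (\<Inter>i\<in>{..<n}. \<Inter>j\<in>{..<n}. {P. P (i, j) = P (j, i)}) \<inter>
      (\<Inter>z. {P. 0 \<le> (\<Sum>i<n. \<Sum>j<n. z i * z j * P (i, j))})"
    by (auto simp: psd_def)
  moreover have "closed \<dots>"
    by (intro closed_Int closed_INT ballI allI closed_Collect_eq closed_Collect_le continuous_intros
        continuous_on_product_coordinates)
  ultimately show ?thesis by simp
qed

text \<open>Strong duality of the semidefinite program: the residual of a positive semidefinite
  matrix closest to the rigidity constraints is itself dual feasible, and the dual bound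
  forces it to vanish.\<close>

lemma rigid_vec_coloring_dual:
  assumes k: "1 < k" and E: "E \<subseteq> all_pairs n"
    and dual: "\<And>D. psd n D \<Longrightarrow> (\<And>i j. i < n \<Longrightarrow> j < n \<Longrightarrow> i \<noteq> j \<Longrightarrow> {i, j} \<notin> E \<Longrightarrow> D i j \<le> 0)
        \<Longrightarrow> (\<Sum>i<n. \<Sum>j<n. D i j) \<le> k * (\<Sum>i<n. D i i)"
  shows "\<exists>v. rigid_vec_coloring n E k v"
proof -
  \<comment> \<open>Signed deviation of an entry from its admissible values: \<open>k - 1\<close> on
    the diagonal, -1 on edges, at least -1 on other pairs. These describe Gram matrices of rigid
    colourings multiplied by \<open>k - 1\<close>; \<open>r\<close> is also half the derivative of
    its own square.\<close>
  define r where "r = (\<lambda>i j (t::real). if i = j then t - (k - 1)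
      else if {i, j} \<in> E then t + 1 else min (t + 1) 0)"
  define g where "g = (\<lambda>P. \<Sum>i<n. \<Sum>j<n. (r i j (P (i, j)))\<^sup>2)"
  \<comment> \<open>A positive semidefinite matrix that does no worse than the zero matrix has
    diagonal at most \<open>B\<close>, hence all entries within \<open>B\<close>. Minimising over
    the compact box therefore minimises over all positive semidefinite matrices.\<close>
  define B where "B = k - 1 + sqrt (g (\<lambda>_. 0))"
  define S where "S = {P. psd n (curry P)} \<inter> {P. \<forall>i. \<bar>P i\<bar> \<le> B}"
  have g_nonneg: "0 \<le> g P" for P
    by (simp add: g_def sum_nonneg)
  have B: "0 \<le> B" using k g_nonneg by (simp add: B_def)
  have psd0: "psd n (curry (\<lambda>_. 0))" by (simp add: psd_def)
  have "compact S"
    unfolding S_def by (rule closed_Int_compact[OF closed_psd compact_box_fun])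
  moreover have "(\<lambda>_. 0) \<in> S"
    using psd0 B by (simp add: S_def)
  moreover have cont_r: "continuous_on UNIV (\<lambda>P :: nat \<times> nat \<Rightarrow> real. r i j (P (i, j)))" for i j
    unfolding r_def
    by (cases "i = j"; cases "{i, j} \<in> E")
       (auto intro!: continuous_intros continuous_on_product_coordinates)
  have "continuous_on S g"
    unfolding g_def
    by (intro continuous_on_sum continuous_on_power continuous_on_subset[OF cont_r]) auto
  ultimately obtain P where P: "P \<in> S" "\<And>Q. Q \<in> S \<Longrightarrow> g P \<le> g Q"
    using continuous_attains_inf[of S g] by blast
  have psdP: "psd n (curry P)" using P by (simp add: S_def)
  have min: "g P \<le> g Q" if Q: "psd n (curry Q)" for Q
  proof (cases "g Q \<le> g (\<lambda>_. 0)")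
    case True
    define Q' where "Q' = (\<lambda>(i, j). if i < n \<and> j < n then Q (i, j) else 0)"
    have "psd n (curry Q')"
      using Q by (subst psd_cong[of n _ "curry Q"]) (simp_all add: Q'_def)
    moreover have diag: "Q (i, i) \<le> B" if "i < n" for i
    proof -
      have "(r i i (Q (i, i)))\<^sup>2 \<le> (\<Sum>j<n. (r i j (Q (i, j)))\<^sup>2)"
        using that by (intro member_le_sum) auto
      also have "\<dots> \<le> g Q"
        unfolding g_def using that by (intro member_le_sum[where i = i]) (auto intro: sum_nonneg)
      also have "\<dots> \<le> g (\<lambda>_. 0)" by (rule True)
      finally have "r i i (Q (i, i)) \<le> sqrt (g (\<lambda>_. 0))" by (rule real_le_rsqrt)
      then show ?thesis by (simp add: r_def B_def)
    qed
    have "\<bar>Q' (i, j)\<bar> \<le> B" for i j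
    proof (cases "i < n \<and> j < n")
      case True
      then have "\<bar>Q (i, j)\<bar> \<le> (Q (i, i) + Q (j, j)) / 2"
        using psd_entry_bound[OF Q, of i j] by simp
      with True diag[of i] diag[of j] show ?thesis by (simp add: Q'_def)
    qed (auto simp: Q'_def B)
    ultimately have "Q' \<in> S" by (simp add: S_def)
    then have "g P \<le> g Q'" by (rule P)
    also have "g Q' = g Q" by (simp add: g_def Q'_def)
    finally show ?thesis .
  next
    case False
    then show ?thesis using P(2)[OF \<open>(\<lambda>_. 0) \<in> S\<close>] by simp
  qed
  define D where "D = (\<lambda>i j. r i j (P (i, j)))"
  \<comment> \<open>A quadratic upper bound on the objective; it replaces differentiation at the
    kink of \<open>min\<close>.\<close>
  have r_step: "(r i j (t + s))\<^sup>2 \<le> (r i j t)\<^sup>2 + 2 * s * r i j t + s\<^sup>2" for i j s t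
  proof -
    have "(min (x + s) 0)\<^sup>2 \<le> (min x 0 + s)\<^sup>2" for x :: real
      by (cases "x \<le> 0"; cases "x + s \<le> 0")
         (auto simp: min_def abs_le_square_iff[symmetric])
    from this[of "t + 1"] show ?thesis
      by (auto simp: r_def power2_eq_square algebra_simps)
  qed
  have variation: "0 \<le> 2 * t * (\<Sum>i<n. \<Sum>j<n. D i j * V (i, j)) + t\<^sup>2 * (\<Sum>i<n. \<Sum>j<n. (V (i, j))\<^sup>2)"
    if "psd n (curry (\<lambda>x. P x + t * V x))" for t V
  proof -
    have "g P \<le> g (\<lambda>x. P x + t * V x)" by (rule min[OF that])
    also have "\<dots> \<le> (\<Sum>i<n. \<Sum>j<n. (D i j)\<^sup>2 + 2 * (t * V (i, j)) * D i j + (t * V (i, j))\<^sup>2)"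
      unfolding g_def D_def by (intro sum_mono r_step)
    also have "\<dots> = g P + 2 * t * (\<Sum>i<n. \<Sum>j<n. D i j * V (i, j)) + t\<^sup>2 * (\<Sum>i<n. \<Sum>j<n. (V (i, j))\<^sup>2)"
      by (simp add: g_def D_def sum.distrib sum_distrib_left power_mult_distrib ac_simps)
    finally show ?thesis by simp
  qed
  have D_sym: "D i j = D j i" if "i < n" "j < n" for i j
    using psd_sym[OF psdP that] by (simp add: D_def r_def insert_commute)
  have "psd n D"
    unfolding psd_def
  proof (intro conjI allI impI)
    fix z :: "nat \<Rightarrow> real"
    \<comment> \<open>Adding a multiple of \<open>z z^T\<close> keeps \<open>P\<close> positive
      semidefinite, so the derivative of \<open>g\<close> in this direction is nonnegative. That
      derivative is twice the form of \<open>D\<close> at \<open>z\<close>.\<close>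
    define V where "V = (\<lambda>(i, j). z i * z j)"
    have "0 \<le> (\<Sum>i<n. \<Sum>j<n. D i j * V (i, j))"
    proof (rule first_order_nonneg)
      fix t :: real assume t: "0 < t"
      have "psd n (curry (\<lambda>x. P x + t * V x))"
        unfolding psd_def
      proof (intro conjI allI impI)
        show "curry (\<lambda>x. P x + t * V x) i j = curry (\<lambda>x. P x + t * V x) j i" if "i < n" "j < n" for i j
          using psd_sym[OF psdP that] by (simp add: V_def)
        fix y :: "nat \<Rightarrow> real"
        have "(\<Sum>i<n. \<Sum>j<n. y i * y j * curry (\<lambda>x. P x + t * V x) i j)
          = (\<Sum>i<n. \<Sum>j<n. y i * y j * curry P i j) + t * (\<Sum>i<n. \<Sum>j<n. (y i * z i) * (y j * z j))"
          by (simp add: V_def distrib_left sum.distrib sum_distrib_left ac_simps)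
        also have "(\<Sum>i<n. \<Sum>j<n. (y i * z i) * (y j * z j)) = (\<Sum>i<n. y i * z i)\<^sup>2"
          by (simp add: power2_eq_square sum_product)
        finally show "0 \<le> (\<Sum>i<n. \<Sum>j<n. y i * y j * curry (\<lambda>x. P x + t * V x) i j)"
          using psd_quad[OF psdP, of y] t by simp
      qed
      then show "0 \<le> 2 * t * (\<Sum>i<n. \<Sum>j<n. D i j * V (i, j)) + t\<^sup>2 * (\<Sum>i<n. \<Sum>j<n. (V (i, j))\<^sup>2)"
        by (rule variation)
    qed (simp add: sum_nonneg)
    then show "0 \<le> (\<Sum>i<n. \<Sum>j<n. z i * z j * D i j)"
      by (simp add: V_def ac_simps)
  qed (rule D_sym)
  moreover have "D i j \<le> 0" if "i \<noteq> j" "{i, j} \<notin> E" for i j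
    using that by (simp add: D_def r_def)
  ultimately have dualD: "(\<Sum>i<n. \<Sum>j<n. D i j) \<le> k * (\<Sum>i<n. D i i)"
    by (intro dual) auto
  \<comment> \<open>The second admissible direction: shrinking \<open>P\<close> towards 0.\<close>
  have "0 \<le> (\<Sum>i<n. \<Sum>j<n. D i j * (- P (i, j)))"
  proof (rule first_order_nonneg)
    fix t :: real assume t: "0 < t" "t < 1"
    have "psd n (curry (\<lambda>x. P x + t * - P x))"
      using psd_restrict[OF psdP, of "\<lambda>_. sqrt (1 - t)"] t
      by (simp add: algebra_simps curry_def)
    then show "0 \<le> 2 * t * (\<Sum>i<n. \<Sum>j<n. D i j * (- P (i, j))) + t\<^sup>2 * (\<Sum>i<n. \<Sum>j<n. (- P (i, j))\<^sup>2)"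
      by (rule variation)
  qed (simp add: sum_nonneg)
  then have DP: "(\<Sum>i<n. \<Sum>j<n. D i j * P (i, j)) \<le> 0"
    by (simp add: sum_negf)
  \<comment> \<open>Where \<open>D\<close> is nonzero, \<open>P\<close> is \<open>D\<close> plus the
    target value, which is \<open>k - 1\<close> on the diagonal and -1 elsewhere. Summed, the dual
    bound cancels all but the squares.\<close>
  have "D i j * P (i, j) = (D i j)\<^sup>2 + (if i = j then k * D i i else 0) - D i j" for i j
    by (auto simp: D_def r_def min_def power2_eq_square algebra_simps)
  then have "(\<Sum>i<n. \<Sum>j<n. D i j * P (i, j))
      = (\<Sum>i<n. \<Sum>j<n. (D i j)\<^sup>2) + k * (\<Sum>i<n. D i i) - (\<Sum>i<n. \<Sum>j<n. D i j)"
    by (simp add: sum.distrib sum_subtractf sum_distrib_left sum.delta')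
  with DP dualD have "(\<Sum>i<n. \<Sum>j<n. (D i j)\<^sup>2) \<le> 0" by simp
  then have "(\<Sum>i<n. \<Sum>j<n. (D i j)\<^sup>2) = 0"
    by (simp add: antisym sum_nonneg)
  then have D0: "D i j = 0" if "i < n" "j < n" for i j
    using that by (simp add: sum_nonneg_eq_0_iff sum_nonneg)
  have "psd n (\<lambda>i j. 1 / sqrt (k - 1) * (1 / sqrt (k - 1)) * curry P i j)"
    by (rule psd_restrict[OF psdP])
  then obtain v where "\<forall>i<n. \<forall>j<n. ip n (v i) (v j) = 1 / sqrt (k - 1) * (1 / sqrt (k - 1)) * curry P i j"
    using psd_gram_ex by blast
  then have v: "ip n (v i) (v j) = P (i, j) / (k - 1)" if "i < n" "j < n" for i j
    using that k by simp
  have "rigid_vec_coloring n E k v"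
    unfolding rigid_vec_coloring_def unit_tuple_def
  proof (intro conjI allI impI)
    show "ip n (v i) (v i) = 1" if "i < n" for i
      using D0[OF that that] k by (simp add: v that D_def r_def)
    show "ip n (v i) (v j) = - 1 / (k - 1)" if "i < n" "j < n" "{i, j} \<in> E" for i j
    proof (cases "i = j")
      case False
      then have "P (i, j) = - 1" using D0[OF that(1,2)] that by (simp add: D_def r_def)
      then show ?thesis using that by (simp add: v)
    next
      case True
      then show ?thesis using E that in_all_pairs_iff by blast
    qed
    show "- 1 / (k - 1) \<le> ip n (v i) (v j)" if "i < n" "j < n" "i \<noteq> j \<and> {i, j} \<notin> E" for i j
    proof -
      have "- 1 \<le> P (i, j)"
        using D0[OF that(1,2)] that by (simp add: D_def r_def min_def split: if_splits)
      then show ?thesis using k that divide_right_mono[of "- 1" "P (i, j)" "k - 1"] by (simp add: v)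
    qed
  qed
  then show ?thesis by blast
qed

section \<open>Feasibility and the order of the three parameters\<close>

lemma vec_le_strict: "strict_vec_coloring n E k v \<Longrightarrow> vec_coloring n E k v"
  by (auto simp: strict_vec_coloring_def vec_coloring_def)

lemma strict_le_rigid: "rigid_vec_coloring n E k v \<Longrightarrow> strict_vec_coloring n E k v"
  by (auto simp: strict_vec_coloring_def rigid_vec_coloring_def)

lemma psd_sum_le:
  fixes G :: "nat \<Rightarrow> nat \<Rightarrow> real"
  assumes "psd n G" "finite H" "H \<subseteq> {..<n}"
  shows "(\<Sum>i\<in>H. \<Sum>j\<in>H. G i j) \<le> card H * (\<Sum>i\<in>H. G i i)"
proof -
  have "G i j \<le> (G i i + G j j) / 2" if "i \<in> H" "j \<in> H" for i j
    using psd_entry_bound[OF assms(1), of i j] that assms(3) by (auto simp: subset_iff)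
  then have "(\<Sum>i\<in>H. \<Sum>j\<in>H. G i j) \<le> (\<Sum>i\<in>H. \<Sum>j\<in>H. (G i i + G j j) / 2)"
    by (intro sum_mono)
  also have "\<dots> = card H * (\<Sum>i\<in>H. G i i)"
    by (simp add: add_divide_distrib sum.distrib sum_divide_distrib[symmetric] sum_distrib_left[symmetric])
  finally show ?thesis .
qed

text \<open>The regular simplex is such a colouring; here it comes from duality with the trivial
  bound \<open>psd_sum_le\<close>. It makes the sets behind all infima nonempty, without which
  \<open>Inf\<close> would carry no information.\<close>

lemma rigid_vec_coloring_ex:
  assumes "2 \<le> n" "E \<subseteq> all_pairs n"
  shows "\<exists>v. rigid_vec_coloring n E (real n) v"
  using assms psd_sum_le[of n _ "{..<n}"] by (intro rigid_vec_coloring_dual) auto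

lemma theta_bar_half_le_theta_bar:
  assumes "2 \<le> n" "E \<subseteq> all_pairs n"
  shows "theta_bar_half n E \<le> theta_bar n E"
proof -
  obtain v where "rigid_vec_coloring n E (real n) v" using rigid_vec_coloring_ex[OF assms] ..
  then have "real n \<in> {k. k > 1 \<and> (\<exists>v. strict_vec_coloring n E k v)}"
    using assms(1) strict_le_rigid[of n E "real n" v] by auto
  moreover have "bdd_below {k. k > 1 \<and> (\<exists>v. vec_coloring n E k v)}"
    by (rule bdd_belowI[of _ 1]) auto
  ultimately show ?thesis
    unfolding theta_bar_half_def theta_bar_def
    by (intro cInf_superset_mono) (blast intro: vec_le_strict)+
qed

lemma theta_bar_le_theta_bar_2:
  assumes "2 \<le> n" "E \<subseteq> all_pairs n"
  shows "theta_bar n E \<le> theta_bar_2 n E"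
proof -
  obtain v where "rigid_vec_coloring n E (real n) v" using rigid_vec_coloring_ex[OF assms] ..
  then have "real n \<in> {k. k > 1 \<and> (\<exists>v. rigid_vec_coloring n E k v)}"
    using assms(1) by auto
  moreover have "bdd_below {k. k > 1 \<and> (\<exists>v. strict_vec_coloring n E k v)}"
    by (rule bdd_belowI[of _ 1]) auto
  ultimately show ?thesis
    unfolding theta_bar_2_def theta_bar_def
    by (intro cInf_superset_mono) (blast intro: strict_le_rigid)+
qed

lemma theta_bar_2_le_dual:
  assumes "1 < k" "E \<subseteq> all_pairs n"
    and "\<And>D. psd n D \<Longrightarrow> (\<And>i j. i < n \<Longrightarrow> j < n \<Longrightarrow> i \<noteq> j \<Longrightarrow> {i, j} \<notin> E \<Longrightarrow> D i j \<le> 0)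
        \<Longrightarrow> (\<Sum>i<n. \<Sum>j<n. D i j) \<le> k * (\<Sum>i<n. D i i)"
  shows "theta_bar_2 n E \<le> k"
  unfolding theta_bar_2_def
proof (rule cInf_lower)
  show "k \<in> {k. k > 1 \<and> (\<exists>v. rigid_vec_coloring n E k v)}"
    using rigid_vec_coloring_dual[OF assms] assms(1) by auto
  show "bdd_below {k. k > 1 \<and> (\<exists>v. rigid_vec_coloring n E k v)}"
    by (rule bdd_belowI[of _ 1]) auto
qed

section \<open>Weak duality between a graph and its complement\<close>

lemma psd_ip: "psd n (\<lambda>i j. ip n (v i) (v j))"
  by (rule psd_gram[where K = "{..<n}" and x = v]) (simp add: ip_def)

text \<open>Schur's product theorem: the entrywise product of two Gram matrices is the Gram matrix
  of the tensor products.\<close>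

lemma sum_ip_prod_nonneg: "0 \<le> (\<Sum>i<n. \<Sum>j<n. ip n (v i) (v j) * ip n (w i) (w j))"
proof -
  have "ip n (v i) (v j) * ip n (w i) (w j) =
      (\<Sum>x\<in>{..<n} \<times> {..<n}. (v i (fst x) * w i (snd x)) * (v j (fst x) * w j (snd x)))" for i j
    unfolding ip_def sum_product sum.cartesian_product by (rule sum.cong) (auto simp: ac_simps)
  then have "psd n (\<lambda>i j. ip n (v i) (v j) * ip n (w i) (w j))"
    by (intro psd_gram[where x = "\<lambda>i x. v i (fst x) * w i (snd x)"])
  from psd_quad[OF this, of "\<lambda>_. 1"] show ?thesis by simp
qed

text \<open>\<open>F\<close> is the entrywise product of \<open>(k - 1) V + J\<close> and
  \<open>(l - 1) W + J\<close>. Its diagonal is \<open>k * l\<close>. Off the diagonal it is at most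
  0: on pairs outside \<open>E\<close> the first factor vanishes, on \<open>E\<close> the factors
  have opposite signs, the first one by rigidity of \<open>v\<close>. Expanding the product and
  using Schur's theorem, the entries sum to at least \<open>n^2\<close>, so
  \<open>n^2 \<le> n * k * l\<close>.\<close>

lemma weak_duality:
  assumes "1 < k" "1 < l" "E \<subseteq> all_pairs n"
    and v: "rigid_vec_coloring n (compl_graph n E) k v" and w: "vec_coloring n E l w"
  shows "real n \<le> k * l"
proof (cases "n = 0")
  case False
  define V W where "V = (\<lambda>i j. ip n (v i) (v j))" and "W = (\<lambda>i j. ip n (w i) (w j))"
  define F where "F = (\<lambda>i j. ((k - 1) * V i j + 1) * ((l - 1) * W i j + 1))"
  have F_le: "F i j \<le> (if i = j then k * l else 0)" if ij: "i < n" "j < n" for i j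
  proof -
    consider "i = j" | "i \<noteq> j" "{i, j} \<in> compl_graph n E" | "i \<noteq> j" "{i, j} \<in> E" "{i, j} \<notin> compl_graph n E"
      using ij in_all_pairs_iff[of i j n] unfolding compl_graph_def by blast
    then show ?thesis
    proof cases
      case 1
      then show ?thesis
        using v w that by (simp add: F_def V_def W_def rigid_vec_coloring_def vec_coloring_def unit_tuple_def)
    next
      case 2
      then have "V i j = - 1 / (k - 1)" using v that by (auto simp: rigid_vec_coloring_def V_def)
      then have "(k - 1) * V i j + 1 = 0" using assms(1) by simp
      with 2 show ?thesis by (simp add: F_def)
    next
      case 3
      then have "- 1 / (k - 1) \<le> V i j" "W i j \<le> - 1 / (l - 1)"
        using v w that by (auto simp: rigid_vec_coloring_def vec_coloring_def V_def W_def)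
      then have "0 \<le> (k - 1) * V i j + 1" "(l - 1) * W i j + 1 \<le> 0"
        using assms(1,2) by (simp_all add: field_simps)
      with 3 show ?thesis by (simp add: F_def mult_nonneg_nonpos)
    qed
  qed
  have "(\<Sum>i<n. \<Sum>j<n. F i j) = (k - 1) * (l - 1) * (\<Sum>i<n. \<Sum>j<n. V i j * W i j)
      + (k - 1) * (\<Sum>i<n. \<Sum>j<n. 1 * 1 * V i j) + (l - 1) * (\<Sum>i<n. \<Sum>j<n. 1 * 1 * W i j) + real n * real n"
    by (simp add: F_def algebra_simps sum.distrib sum_distrib_left sum_subtractf)
  moreover have "0 \<le> (\<Sum>i<n. \<Sum>j<n. V i j * W i j)"
    unfolding V_def W_def by (rule sum_ip_prod_nonneg)
  moreover have "0 \<le> (\<Sum>i<n. \<Sum>j<n. 1 * 1 * V i j)" "0 \<le> (\<Sum>i<n. \<Sum>j<n. 1 * 1 * W i j)"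
    unfolding V_def W_def by (rule psd_quad[OF psd_ip])+
  ultimately have "real n * real n \<le> (\<Sum>i<n. \<Sum>j<n. F i j)"
    using assms(1,2) by simp
  also have "\<dots> \<le> (\<Sum>i<n. \<Sum>j<n. if i = j then k * l else 0)"
    using F_le by (intro sum_mono) auto
  also have "\<dots> = real n * (k * l)" by simp
  finally show ?thesis using False by simp
qed (use assms in simp)

lemma theta_bar_half_ge:
  assumes "2 \<le> n" "E \<subseteq> all_pairs n" and K: "theta_bar_2 n (compl_graph n E) \<le> K"
  shows "real n / K \<le> theta_bar_half n E"
proof -
  let ?R = "{k. k > 1 \<and> (\<exists>v. rigid_vec_coloring n (compl_graph n E) k v)}"
  let ?H = "{k. k > 1 \<and> (\<exists>v. vec_coloring n E k v)}"
  have "compl_graph n E \<subseteq> all_pairs n" by (auto simp: compl_graph_def)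
  from rigid_vec_coloring_ex[OF assms(1) this] have R: "real n \<in> ?R"
    using assms(1) by simp
  from rigid_vec_coloring_ex[OF assms(1,2)] have H: "real n \<in> ?H"
    using assms(1) by (auto intro: vec_le_strict[OF strict_le_rigid])
  have "1 \<le> theta_bar_2 n (compl_graph n E)"
    unfolding theta_bar_2_def using R by (intro cInf_greatest) (blast, simp)
  then have K1: "1 \<le> K" using K by simp
  show ?thesis
    unfolding theta_bar_half_def
  proof (rule cInf_greatest)
    fix l assume l: "l \<in> ?H"
    have "real n / l \<le> theta_bar_2 n (compl_graph n E)"
      unfolding theta_bar_2_def
    proof (rule cInf_greatest)
      fix k assume "k \<in> ?R"
      with l weak_duality[OF _ _ assms(2)] have "real n \<le> k * l" by auto
      with l show "real n / l \<le> k" by (simp add: field_simps)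
    qed (use R in blast)
    with K have "real n / l \<le> K" by simp
    with l have "real n \<le> K * l" by (simp add: field_simps)
    then show "real n / K \<le> l" using K1 by (simp add: field_simps)
  qed (use H in blast)
qed

lemma compl_compl_graph: "E \<subseteq> all_pairs n \<Longrightarrow> compl_graph n (compl_graph n E) = E"
  by (auto simp: compl_graph_def)

section \<open>Grothendieck rounding\<close>

text \<open>\<open>S\<close> is the set of coordinates with sign +1, so averages over
  \<open>Pow {..<n}\<close> are expectations over random signs. These sums replace the Gaussian
  projections of Grothendieck's argument; second and fourth moments are all it takes.\<close>

definition rademacher :: "nat \<Rightarrow> (nat \<Rightarrow> real) \<Rightarrow> nat set \<Rightarrow> real" where
  "rademacher n a S = (\<Sum>k<n. if k \<in> S then a k else - a k)"

lemma sum_Pow_Suc: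
  fixes F :: "nat set \<Rightarrow> real"
  shows "(\<Sum>S\<in>Pow {..<Suc n}. F S) = (\<Sum>S\<in>Pow {..<n}. F (insert n S) + F S)"
proof -
  have inj: "inj_on (insert n) (Pow {..<n})"
    by (auto simp: inj_on_def)
  have "(\<Sum>S\<in>Pow {..<Suc n}. F S) = (\<Sum>S\<in>Pow {..<n}. F S) + (\<Sum>S\<in>insert n ` Pow {..<n}. F S)"
    unfolding lessThan_Suc Pow_insert by (rule sum.union_disjoint) auto
  also have "\<dots> = (\<Sum>S\<in>Pow {..<n}. F S) + (\<Sum>S\<in>Pow {..<n}. F (insert n S))"
    by (simp add: sum.reindex[OF inj])
  finally show ?thesis by (simp add: sum.distrib)
qed

lemma rademacher_Suc:
  assumes "S \<subseteq> {..<n}"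
  shows "rademacher (Suc n) a (insert n S) = rademacher n a S + a n"
    and "rademacher (Suc n) a S = rademacher n a S - a n"
proof -
  have "rademacher n a (insert n S) = rademacher n a S"
    unfolding rademacher_def by (intro sum.cong) auto
  then show "rademacher (Suc n) a (insert n S) = rademacher n a S + a n"
    by (simp add: rademacher_def)
  show "rademacher (Suc n) a S = rademacher n a S - a n"
    using assms by (auto simp: rademacher_def)
qed

lemma rademacher_second_moment:
  "(\<Sum>S\<in>Pow {..<n}. rademacher n a S * rademacher n b S) = 2 ^ n * (\<Sum>k<n. a k * b k)"
proof (induction n)
  case 0
  show ?case by (simp add: rademacher_def)
next
  case (Suc n)
  have "(\<Sum>S\<in>Pow {..<Suc n}. rademacher (Suc n) a S * rademacher (Suc n) b S)
      = (\<Sum>S\<in>Pow {..<n}. 2 * (rademacher n a S * rademacher n b S) + 2 * (a n * b n))"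
    unfolding sum_Pow_Suc by (intro sum.cong refl) (simp add: rademacher_Suc algebra_simps)
  also have "\<dots> = 2 * (2 ^ n * (\<Sum>k<n. a k * b k)) + 2 ^ n * (2 * (a n * b n))"
    by (simp add: sum.distrib sum_distrib_left[symmetric] Suc card_Pow)
  finally show ?case by (simp add: algebra_simps)
qed

lemma rademacher_fourth_moment:
  "(\<Sum>S\<in>Pow {..<n}. (rademacher n a S) ^ 4) \<le> 3 * 2 ^ n * (\<Sum>k<n. (a k)\<^sup>2)\<^sup>2"
proof (induction n)
  case 0
  show ?case by (simp add: rademacher_def)
next
  case (Suc n)
  define s where "s = (\<Sum>k<n. (a k)\<^sup>2)"
  have "(\<Sum>S\<in>Pow {..<Suc n}. (rademacher (Suc n) a S) ^ 4)
      = (\<Sum>S\<in>Pow {..<n}. 2 * (rademacher n a S) ^ 4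
          + 12 * (a n)\<^sup>2 * (rademacher n a S * rademacher n a S) + 2 * (a n) ^ 4)"
    unfolding sum_Pow_Suc
    by (intro sum.cong refl) (simp add: rademacher_Suc power4_eq_xxxx power2_eq_square algebra_simps)
  also have "\<dots> = 2 * (\<Sum>S\<in>Pow {..<n}. (rademacher n a S) ^ 4)
      + 12 * (a n)\<^sup>2 * (2 ^ n * s) + 2 ^ n * (2 * (a n) ^ 4)"
    by (simp add: sum.distrib sum_distrib_left[symmetric] rademacher_second_moment s_def
        power2_eq_square card_Pow)
  \<comment> \<open>The last coefficient is raised from 2 to 6 to complete the square.\<close>
  also have "\<dots> \<le> 2 * (3 * 2 ^ n * s\<^sup>2) + 12 * (a n)\<^sup>2 * (2 ^ n * s) + 2 ^ n * (6 * (a n) ^ 4)"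
    unfolding s_def by (intro add_mono mult_left_mono Suc) auto
  also have "\<dots> = 3 * 2 ^ Suc n * (s + (a n)\<^sup>2)\<^sup>2"
    by (simp add: power4_eq_xxxx power2_eq_square algebra_simps)
  finally show ?case by (simp add: s_def)
qed

definition trunc :: "real \<Rightarrow> real \<Rightarrow> real" where
  "trunc K x = max (- K) (min K x)"

lemma trunc_le: "0 \<le> K \<Longrightarrow> \<bar>trunc K x\<bar> \<le> K"
  by (auto simp: trunc_def)

lemma trunc_square_le: "0 \<le> K \<Longrightarrow> (trunc K x)\<^sup>2 \<le> x\<^sup>2"
  by (auto simp: trunc_def abs_le_square_iff[symmetric] max_def min_def)

text \<open>The excess over \<open>K\<close> is at most \<open>x^2 / (4 * K)\<close> because
  \<open>(\<bar>x\<bar> - 2 * K)^2\<close> is nonnegative. Squaring leaves a fourth power, which the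
  fourth moment controls.\<close>

lemma trunc_error:
  assumes "0 < K"
  shows "(x - trunc K x)\<^sup>2 \<le> x ^ 4 / (16 * K\<^sup>2)"
proof (cases "\<bar>x\<bar> \<le> K")
  case True
  then have "trunc K x = x" by (auto simp: trunc_def)
  then show ?thesis by simp
next
  case False
  have "\<bar>x - trunc K x\<bar> = \<bar>x\<bar> - K"
    using False assms by (auto simp: trunc_def max_def min_def)
  moreover have "(\<bar>x\<bar> - K) * K \<le> \<bar>x\<bar>\<^sup>2 / 4"
    using zero_le_power2[of "\<bar>x\<bar> - 2 * K"] by (simp add: power2_eq_square algebra_simps)
  ultimately have "(\<bar>x - trunc K x\<bar> * K)\<^sup>2 \<le> (\<bar>x\<bar>\<^sup>2 / 4)\<^sup>2"
    using assms by (intro power_mono) auto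
  also have "\<dots> = x ^ 4 / 16" by (simp add: power4_eq_xxxx power2_eq_square)
  finally have "(x - trunc K x)\<^sup>2 * K\<^sup>2 \<le> x ^ 4 / 16" by (simp add: power_mult_distrib)
  then show ?thesis using assms by (simp add: field_simps)
qed

text \<open>Grothendieck's rounding argument: write \<open>G\<close> as a Gram matrix, replace the vectors by their
  Rademacher sums and truncate. The tails are again vectors of the same kind, shrunk by the
  factor \<open>1/8\<close>, so the supremum \<open>B\<close> over all admissible \<open>G\<close> bounds their contribution.\<close>

lemma grothendieck_truncated:
  fixes M :: "nat \<Rightarrow> nat \<Rightarrow> real"
  assumes scalar: "\<And>z. (\<And>i. i < n \<Longrightarrow> \<bar>z i\<bar> \<le> R) \<Longrightarrow>
      \<bar>\<Sum>i<n. \<Sum>j<n. M i j * (z i * z j)\<bar> \<le> c * (\<tau> + (\<Sum>i<n. (z i)\<^sup>2))"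
    and R: "0 < R" and c: "0 \<le> c"
    and G: "psd n G" "\<And>i. i < n \<Longrightarrow> G i i \<le> R\<^sup>2" "(\<Sum>i<n. G i i) \<le> \<tau>"
  shows "\<bar>\<Sum>i<n. \<Sum>j<n. M i j * G i j\<bar> \<le> 36 * c * \<tau>"
proof -
  define m where "m = (\<lambda>G. \<Sum>i<n. \<Sum>j<n. M i j * G i j)"
  define \<X> where "\<X> = {G. psd n G \<and> (\<forall>i<n. G i i \<le> R\<^sup>2) \<and> (\<Sum>i<n. G i i) \<le> \<tau>}"
  define B where "B = (SUP G\<in>\<X>. \<bar>m G\<bar>)"
  have G\<X>: "G \<in> \<X>" using G by (simp add: \<X>_def)
  have "\<bar>m H\<bar> \<le> (\<Sum>i<n. \<Sum>j<n. \<bar>M i j\<bar> * R\<^sup>2)" if H: "H \<in> \<X>" for H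
  proof -
    have "\<bar>H i j\<bar> \<le> R\<^sup>2" if "i < n" "j < n" for i j
    proof -
      have "H i i \<le> R\<^sup>2" "H j j \<le> R\<^sup>2" using H that by (auto simp: \<X>_def)
      moreover have "\<bar>H i j\<bar> \<le> (H i i + H j j) / 2"
        using H that by (intro psd_entry_bound) (auto simp: \<X>_def)
      moreover have "(H i i + H j j) / 2 \<le> (R\<^sup>2 + R\<^sup>2) / 2"
        using calculation by (intro divide_right_mono add_mono) auto
      ultimately show ?thesis by simp
    qed
    then show ?thesis
      unfolding m_def
      by (intro order.trans[OF sum_abs] sum_mono) (auto simp: abs_mult intro!: mult_left_mono)
  qed
  \<comment> \<open>Finiteness of the supremum is what allows the final inequality to be solved for
    \<open>B\<close>.\<close>
  then have bdd: "bdd_above ((\<lambda>G. \<bar>m G\<bar>) ` \<X>)"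
    by (intro bdd_aboveI2)
  have m_le: "\<bar>m H\<bar> \<le> B" if "H \<in> \<X>" for H
    unfolding B_def using bdd that by (intro cSUP_upper)
  have \<tau>: "0 \<le> \<tau>"
    using G(3) sum_nonneg[of "{..<n}" "\<lambda>i. G i i"] psd_diag_nonneg[OF G(1)] by force
  have step: "\<bar>m H\<bar> \<le> 17 * c * \<tau> + 33 / 64 * B" if H: "H \<in> \<X>" for H
  proof -
    have psdH: "psd n H" and H2: "\<And>i. i < n \<Longrightarrow> H i i \<le> R\<^sup>2" and H3: "(\<Sum>i<n. H i i) \<le> \<tau>"
      using H by (auto simp: \<X>_def)
    obtain v where v: "\<And>i j. i < n \<Longrightarrow> j < n \<Longrightarrow> ip n (v i) (v j) = H i j"
      using psd_gram_ex[OF psdH] by blast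
    define \<Omega> where "\<Omega> = Pow {..<n}"
    define N :: real where "N = 2 ^ n"
    define X where "X = (\<lambda>i. rademacher n (v i))"
    \<comment> \<open>The level \<open>4 * R\<close> makes the tail small; the scalar bound is then
      applied to \<open>T / 4\<close>, at the price of a factor 16.\<close>
    define T where "T = (\<lambda>i S. trunc (4 * R) (X i S))"
    define \<Delta> where "\<Delta> = (\<lambda>i S. X i S - T i S)"
    define gr where "gr = (\<lambda>(f :: nat \<Rightarrow> nat set \<Rightarrow> real) i j. (\<Sum>S\<in>\<Omega>. f i S * f j S) / N)"
    have N: "0 < N" by (simp add: N_def)
    have XX: "(\<Sum>S\<in>\<Omega>. X i S * X j S) = N * H i j" if "i < n" "j < n" for i j
      using v[OF that] by (simp add: X_def \<Omega>_def N_def rademacher_second_moment ip_def)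
    have T2: "(\<Sum>S\<in>\<Omega>. (T i S)\<^sup>2) \<le> N * H i i" if "i < n" for i
    proof -
      have "(\<Sum>S\<in>\<Omega>. (T i S)\<^sup>2) \<le> (\<Sum>S\<in>\<Omega>. (X i S)\<^sup>2)"
        unfolding T_def using R by (intro sum_mono trunc_square_le) simp
      then show ?thesis using XX[OF that that] by (simp add: power2_eq_square)
    qed
    \<comment> \<open>\<open>trunc_error\<close> at level \<open>4 * R\<close> and the fourth moment
      give \<open>3 / 256 * H i i^2 / R^2\<close>, and the cap \<open>H i i \<le> R^2\<close> brings
      this below \<open>H i i / 64\<close>. So the tails enlarged by 8 are admissible again.\<close>
    have D2: "(\<Sum>S\<in>\<Omega>. (8 * \<Delta> i S)\<^sup>2) \<le> N * H i i" if i: "i < n" for i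
    proof -
      have "(\<Sum>S\<in>\<Omega>. (\<Delta> i S)\<^sup>2) \<le> (\<Sum>S\<in>\<Omega>. (X i S) ^ 4 / (16 * (4 * R)\<^sup>2))"
        unfolding \<Delta>_def T_def using R by (intro sum_mono trunc_error) simp
      also have "\<dots> = (\<Sum>S\<in>\<Omega>. (X i S) ^ 4) / (256 * R\<^sup>2)"
        by (simp add: sum_divide_distrib power_mult_distrib)
      also have "\<dots> \<le> (3 * N * (H i i)\<^sup>2) / (256 * R\<^sup>2)"
      proof (intro divide_right_mono)
        have "(\<Sum>k<n. (v i k)\<^sup>2) = H i i" using v[OF i i] by (simp add: ip_def power2_eq_square)
        then show "(\<Sum>S\<in>\<Omega>. (X i S) ^ 4) \<le> 3 * N * (H i i)\<^sup>2"
          using rademacher_fourth_moment[of n "v i"] by (simp add: X_def \<Omega>_def N_def)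
      qed simp
      also have "\<dots> \<le> (3 * N * (H i i * R\<^sup>2)) / (256 * R\<^sup>2)"
        using H2[OF i] psd_diag_nonneg[OF psdH i] N
        by (intro divide_right_mono mult_left_mono) (auto simp: power2_eq_square intro!: mult_left_mono)
      also have "\<dots> = 3 / 256 * (N * H i i)" using R by simp
      also have "\<dots> \<le> 1 / 64 * (N * H i i)"
        using psd_diag_nonneg[OF psdH i] N by (intro mult_right_mono) auto
      finally show ?thesis by (simp add: power_mult_distrib sum_distrib_left[symmetric])
    qed
    have gr\<X>: "gr f \<in> \<X>" if f: "\<And>i. i < n \<Longrightarrow> (\<Sum>S\<in>\<Omega>. (f i S)\<^sup>2) \<le> N * H i i" for f
    proof -
      have "psd n (gr f)"
        by (rule psd_gram[where K = \<Omega> and x = "\<lambda>i S. f i S / sqrt N"])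
           (use N in \<open>simp add: gr_def sum_divide_distrib\<close>)
      moreover have "gr f i i \<le> H i i" if "i < n" for i
        using f[OF that] N by (simp add: gr_def power2_eq_square field_simps)
      moreover from this have "(\<Sum>i<n. gr f i i) \<le> (\<Sum>i<n. H i i)"
        by (intro sum_mono) auto
      ultimately show ?thesis
        unfolding \<X>_def using H2 H3 by (auto intro: order.trans)
    qed
    \<comment> \<open>Polarisation: the mixed terms of \<open>T\<close> and \<open>\<Delta>\<close>
      equal a quarter of the difference of the Gram matrices of \<open>P\<close> and
      \<open>P'\<close>, which are again admissible.\<close>
    define P where "P = (\<lambda>i S. (T i S + 8 * \<Delta> i S) / 2)"
    define P' where "P' = (\<lambda>i S. (T i S - 8 * \<Delta> i S) / 2)"
    have half: "(\<Sum>S\<in>\<Omega>. ((T i S + s * (8 * \<Delta> i S)) / 2)\<^sup>2) \<le> N * H i i" if "i < n" "s\<^sup>2 = 1" for i s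
    proof -
      have "((x + s * y) / 2)\<^sup>2 \<le> (x\<^sup>2 + y\<^sup>2) / 2" for x y
        using zero_le_power2[of "x - s * y"] \<open>s\<^sup>2 = 1\<close>
        by (simp add: power_divide power2_sum power2_diff power_mult_distrib field_simps)
      then have "(\<Sum>S\<in>\<Omega>. ((T i S + s * (8 * \<Delta> i S)) / 2)\<^sup>2)
          \<le> (\<Sum>S\<in>\<Omega>. ((T i S)\<^sup>2 + (8 * \<Delta> i S)\<^sup>2) / 2)"
        by (intro sum_mono)
      also have "\<dots> = ((\<Sum>S\<in>\<Omega>. (T i S)\<^sup>2) + (\<Sum>S\<in>\<Omega>. (8 * \<Delta> i S)\<^sup>2)) / 2"
        by (simp only: sum_divide_distrib[symmetric] sum.distrib)
      finally show ?thesis using T2[OF that(1)] D2[OF that(1)] by simp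
    qed
    have "gr P \<in> \<X>" "gr P' \<in> \<X>"
      using half[of _ 1] half[of _ "-1"] by (auto intro!: gr\<X> simp: P_def P'_def)
    moreover have "gr (\<lambda>i S. 8 * \<Delta> i S) \<in> \<X>"
      by (rule gr\<X>[OF D2])
    ultimately have B: "\<bar>m (gr P)\<bar> \<le> B" "\<bar>m (gr P')\<bar> \<le> B" "\<bar>m (gr (\<lambda>i S. 8 * \<Delta> i S))\<bar> \<le> B"
      by (auto intro: m_le)
    have "H i j = gr T i j + (gr P i j - gr P' i j) / 4 + gr (\<lambda>i S. 8 * \<Delta> i S) i j / 64"
      if "i < n" "j < n" for i j
    proof -
      have "N * H i j = (\<Sum>S\<in>\<Omega>. T i S * T j S + (P i S * P j S - P' i S * P' j S) / 4
          + (8 * \<Delta> i S) * (8 * \<Delta> j S) / 64)"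
        unfolding XX[OF that, symmetric]
        by (intro sum.cong refl) (simp add: P_def P'_def \<Delta>_def field_simps)
      also have "\<dots> = N * (gr T i j + (gr P i j - gr P' i j) / 4 + gr (\<lambda>i S. 8 * \<Delta> i S) i j / 64)"
        using N by (simp only: sum.distrib sum_subtractf sum_divide_distrib[symmetric] gr_def)
          (simp add: field_simps)
      finally show ?thesis using N by simp
    qed
    then have "m H = m (\<lambda>i j. gr T i j + (gr P i j - gr P' i j) / 4 + gr (\<lambda>i S. 8 * \<Delta> i S) i j / 64)"
      unfolding m_def by (intro sum.cong refl) auto
    also have "\<dots> = m (gr T) + (m (gr P) - m (gr P')) / 4 + m (gr (\<lambda>i S. 8 * \<Delta> i S)) / 64"
      by (simp add: m_def distrib_left right_diff_distrib sum.distrib sum_subtractf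
          sum_divide_distrib[symmetric])
    finally have "m H = m (gr T) + m (gr P) / 4 - m (gr P') / 4 + m (gr (\<lambda>i S. 8 * \<Delta> i S)) / 64"
      by (simp add: diff_divide_distrib)
    then have mH: "\<bar>m H\<bar> \<le> \<bar>m (gr T)\<bar> + 33 / 64 * B" using B by linarith
    have "\<bar>m (gr T)\<bar> = \<bar>\<Sum>S\<in>\<Omega>. (\<Sum>i<n. \<Sum>j<n. M i j * (T i S * T j S))\<bar> / N"
    proof -
      have "m (gr T) = (\<Sum>i<n. \<Sum>j<n. \<Sum>S\<in>\<Omega>. M i j * (T i S * T j S)) / N"
        by (simp add: m_def gr_def sum_distrib_left sum_divide_distrib)
      also have "(\<Sum>i<n. \<Sum>j<n. \<Sum>S\<in>\<Omega>. M i j * (T i S * T j S))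
          = (\<Sum>i<n. \<Sum>S\<in>\<Omega>. \<Sum>j<n. M i j * (T i S * T j S))"
        by (intro sum.cong refl sum.swap)
      also have "\<dots> = (\<Sum>S\<in>\<Omega>. \<Sum>i<n. \<Sum>j<n. M i j * (T i S * T j S))"
        by (rule sum.swap)
      finally show ?thesis using N by simp
    qed
    \<comment> \<open>For a single sign pattern the squares of \<open>T\<close> may sum to far more
      than \<tau>; only their average is bounded. Hence the scalar hypothesis has the additive form
      \<open>\<tau>\<close> plus squared length.\<close>
    also have "\<dots> \<le> (\<Sum>S\<in>\<Omega>. c * (16 * \<tau> + (\<Sum>i<n. (T i S)\<^sup>2))) / N"
    proof (rule divide_right_mono, rule order.trans[OF sum_abs], rule sum_mono)
      fix S
      have "\<bar>T i S / 4\<bar> \<le> R" for i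
        using trunc_le[of "4 * R" "X i S"] R by (simp add: T_def)
      then have "\<bar>\<Sum>i<n. \<Sum>j<n. M i j * (T i S / 4 * (T j S / 4))\<bar> \<le> c * (\<tau> + (\<Sum>i<n. (T i S / 4)\<^sup>2))"
        by (intro scalar)
      moreover have "(\<Sum>i<n. \<Sum>j<n. M i j * (T i S / 4 * (T j S / 4))) = (\<Sum>i<n. \<Sum>j<n. M i j * (T i S * T j S)) / 16"
        by (simp add: sum_divide_distrib)
      moreover have "(\<Sum>i<n. (T i S / 4)\<^sup>2) = (\<Sum>i<n. (T i S)\<^sup>2) / 16"
        by (simp add: sum_divide_distrib power_divide)
      ultimately show "\<bar>\<Sum>i<n. \<Sum>j<n. M i j * (T i S * T j S)\<bar> \<le> c * (16 * \<tau> + (\<Sum>i<n. (T i S)\<^sup>2))"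
        by (simp add: algebra_simps)
    qed (use N in simp)
    also have "\<dots> = c * (16 * \<tau> + (\<Sum>i<n. \<Sum>S\<in>\<Omega>. (T i S)\<^sup>2) / N)"
    proof -
      have "(\<Sum>S\<in>\<Omega>. \<Sum>i<n. (T i S)\<^sup>2) = (\<Sum>i<n. \<Sum>S\<in>\<Omega>. (T i S)\<^sup>2)" by (rule sum.swap)
      moreover have "real (card \<Omega>) = N" by (simp add: \<Omega>_def N_def card_Pow)
      ultimately show ?thesis
        using N by (simp add: sum_distrib_left[symmetric] sum.distrib field_simps)
    qed
    also have "\<dots> \<le> c * (16 * \<tau> + (\<Sum>i<n. N * H i i) / N)"
      using N c T2 by (intro mult_left_mono add_left_mono divide_right_mono sum_mono) auto
    also have "\<dots> \<le> c * (16 * \<tau> + \<tau>)"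
      using N c H3 by (intro mult_left_mono add_left_mono) (auto simp: sum_distrib_left[symmetric])
    finally show ?thesis using mH by (simp add: algebra_simps)
  qed
  \<comment> \<open>The coefficient is 1/4 + 1/4 + 1/64, from \<open>P\<close>, \<open>P'\<close>
    and the tails. Solving for \<open>B\<close> gives 17 * 64 / 31, which is below 36.\<close>
  have "B \<le> 17 * c * \<tau> + 33 / 64 * B"
    unfolding B_def using G\<X> step[unfolded B_def] by (intro cSUP_least) auto
  then have "B \<le> 36 * (c * \<tau>)" using c \<tau> mult_nonneg_nonneg[of c \<tau>] by linarith
  then show ?thesis using m_le[OF G\<X>] by (simp add: m_def)
qed

section \<open>Concentration of the centred quadratic form\<close>

text \<open>The inner product of \<open>G\<close> with \<open>A - p(J - I)\<close>, where
  \<open>A\<close> is the adjacency matrix. The zero diagonal is what lets integer rounding work one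
  coordinate at a time.\<close>

definition centered_form :: "nat \<Rightarrow> real \<Rightarrow> nat set set \<Rightarrow> (nat \<Rightarrow> nat \<Rightarrow> real) \<Rightarrow> real" where
  "centered_form n p E G = (\<Sum>i<n. \<Sum>j<n. (if i \<noteq> j then of_bool ({i, j} \<in> E) - p else 0) * G i j)"

lemma affine_le_max_endpoints:
  fixes a b x :: real
  assumes "l \<le> x" "x \<le> u" "a + b * l \<le> K" "a + b * u \<le> K"
  shows "a + b * x \<le> K"
proof (cases "0 \<le> b")
  case True
  then have "b * x \<le> b * u" using assms by (intro mult_left_mono)
  then show ?thesis using assms by simp
next
  case False
  then have "b * x \<le> b * l" using assms by (intro mult_left_mono_neg) auto
  then show ?thesis using assms by simp
qed

lemma quad_form_update_affine:
  fixes M :: "nat \<Rightarrow> nat \<Rightarrow> real"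
  assumes "k < n" "M k k = 0"
  shows "\<exists>a b. \<forall>t. (\<Sum>i<n. \<Sum>j<n. M i j * ((z(k := t)) i * (z(k := t)) j)) = a + b * t"
proof -
  define w where "w = z(k := 0)"
  define e where "e = (\<lambda>i. of_bool (i = k) :: real)"
  have upd: "(z(k := t)) i = w i + t * e i" for t i by (simp add: w_def e_def)
  have ee: "M i j * (e i * e j) = 0" for i j using assms(2) by (auto simp: e_def)
  have "M i j * ((z(k := t)) i * (z(k := t)) j)
      = M i j * (w i * w j) + (M i j * (w i * e j) + M i j * (e i * w j)) * t + M i j * (e i * e j) * t\<^sup>2" for i j t
    unfolding upd by (simp add: algebra_simps power2_eq_square)
  then have "(\<Sum>i<n. \<Sum>j<n. M i j * ((z(k := t)) i * (z(k := t)) j))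
      = (\<Sum>i<n. \<Sum>j<n. M i j * (w i * w j))
       + (\<Sum>i<n. \<Sum>j<n. M i j * (w i * e j) + M i j * (e i * w j)) * t" for t
    unfolding ee by (simp add: sum.distrib sum_distrib_right distrib_right)
  then show ?thesis by (intro exI allI)
qed

text \<open>The form is affine in each coordinate since the diagonal vanishes, hence
  its maximum over a box is attained at a vertex.\<close>

lemma quad_form_round:
  fixes M :: "nat \<Rightarrow> nat \<Rightarrow> real"
  assumes "\<And>i. M i i = 0"
    and "\<And>y. (\<And>i. i < n \<Longrightarrow> y i = of_int \<lfloor>z i\<rfloor> \<or> y i = of_int \<lceil>z i\<rceil>)
          \<Longrightarrow> (\<Sum>i<n. \<Sum>j<n. M i j * (y i * y j)) \<le> K"
  shows "(\<Sum>i<n. \<Sum>j<n. M i j * (z i * z j)) \<le> K"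
proof -
  \<comment> \<open>Induction on the number \<open>m\<close> of coordinates not yet rounded: those
    below \<open>m\<close> agree with \<open>z\<close>, the others are floors or ceilings.\<close>
  have "(\<Sum>i<n. \<Sum>j<n. M i j * (y i * y j)) \<le> K"
    if "m \<le> n" "\<And>i. i < n \<Longrightarrow> m \<le> i \<Longrightarrow> y i = of_int \<lfloor>z i\<rfloor> \<or> y i = of_int \<lceil>z i\<rceil>"
      "\<And>i. i < m \<Longrightarrow> y i = z i" for m and y :: "nat \<Rightarrow> real"
    using that
  proof (induction m arbitrary: y)
    case 0
    then show ?case by (intro assms(2)) simp
  next
    case (Suc m)
    have m: "m < n" using Suc.prems(1) by simp
    obtain a b where ab: "\<And>t. (\<Sum>i<n. \<Sum>j<n. M i j * ((y(m := t)) i * (y(m := t)) j)) = a + b * t"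
      using quad_form_update_affine[where M = M and z = y, OF m assms(1)[of m]] by metis
    have "a + b * t \<le> K" if "t = of_int \<lfloor>z m\<rfloor> \<or> t = of_int \<lceil>z m\<rceil>" for t
      unfolding ab[symmetric]
    proof (rule Suc.IH)
      show "m \<le> n" using m by simp
      show "(y(m := t)) i = of_int \<lfloor>z i\<rfloor> \<or> (y(m := t)) i = of_int \<lceil>z i\<rceil>" if "i < n" "m \<le> i" for i
        using Suc.prems(2)[of i] that \<open>t = _ \<or> t = _\<close> by (cases "i = m") simp_all
      show "(y(m := t)) i = z i" if "i < m" for i
        using Suc.prems(3)[of i] that by simp
    qed
    then have "a + b * z m \<le> K"
      by (intro affine_le_max_endpoints[of "of_int \<lfloor>z m\<rfloor>" "z m" "of_int \<lceil>z m\<rceil>"]) simp_all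
    moreover have "y(m := z m) = y" using Suc.prems(3)[of m] by (simp add: fun_upd_idem)
    ultimately show ?case using ab[of "z m"] by simp
  qed
  from this[of n z] show ?thesis by simp
qed

text \<open>Counting by exponential weights: each vector counted has \<open>exp (s - |z|^2)\<close>
  at least 1, and the sum of these weights over the whole box factorises. One coordinate contributes
  less than 3, hence at most \<open>exp 2\<close>, whatever the range \<open>A\<close>.\<close>

lemma card_int_vectors_le:
  assumes "finite A"
  shows "real (card {z \<in> PiE {..<n} (\<lambda>_. A). (\<Sum>i<n. (real_of_int (z i))\<^sup>2) \<le> s}) \<le> exp (s + 2 * real n)"
proof -
  have finP: "finite (PiE {..<n} (\<lambda>_. A))" using assms by (intro finite_PiE) auto
  have geo: "(\<Sum>k\<in>A. exp (- (real_of_int k)\<^sup>2)) \<le> exp 2"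
  proof -
    obtain m where m: "\<And>k. k \<in> A \<Longrightarrow> \<bar>k\<bar> \<le> int m"
    proof -
      have "k \<in> A \<Longrightarrow> \<bar>k\<bar> \<le> int (\<Sum>k\<in>A. nat \<bar>k\<bar>)" for k
        using member_le_sum[of k A "\<lambda>k. nat \<bar>k\<bar>"] assms by linarith
      then show ?thesis using that by blast
    qed
    have "(\<Sum>k\<in>A. exp (- (real_of_int k)\<^sup>2)) \<le> (\<Sum>k\<in>{- int m..int m}. exp (- (real_of_int k)\<^sup>2))"
    proof (rule sum_mono2)
      show "A \<subseteq> {- int m..int m}"
      proof
        fix k assume "k \<in> A"
        from m[OF this] show "k \<in> {- int m..int m}" by (simp add: abs_le_iff)
      qed
    qed auto
    also have "\<dots> \<le> (\<Sum>k\<in>{- int m..int m}. (1/2) ^ nat \<bar>k\<bar>)"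
    proof (rule sum_mono)
      fix k :: int
      have h: "exp (- 1) \<le> (1 / 2 :: real)"
        using exp_ge_add_one_self[of 1] by (simp add: exp_minus field_simps)
      have "real_of_int \<bar>k\<bar> \<le> real_of_int (\<bar>k\<bar> * \<bar>k\<bar>)"
        unfolding of_int_le_iff using mult_left_mono[of 1 "\<bar>k\<bar>" "\<bar>k\<bar>"] by (cases "k = 0") auto
      then have "exp (- (real_of_int k)\<^sup>2) \<le> exp (real (nat \<bar>k\<bar>) * (- 1))"
        by (simp add: power2_eq_square abs_mult[symmetric])
      also have "\<dots> = exp (- 1) ^ nat \<bar>k\<bar>" by (rule exp_of_nat_mult)
      also have "\<dots> \<le> (1/2) ^ nat \<bar>k\<bar>" by (intro power_mono h) simp
      finally show "exp (- (real_of_int k)\<^sup>2) \<le> (1/2) ^ nat \<bar>k\<bar>" .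
    qed
    also have "\<dots> \<le> exp 2"
    proof -
      have "(\<Sum>k\<in>{- int m..int m}. (1/2) ^ nat \<bar>k\<bar>) = 3 - 2 * (1/2 :: real) ^ m"
      proof (induction m)
        case (Suc m)
        have "{- int (Suc m)..int (Suc m)} = insert (- int (Suc m)) (insert (int (Suc m)) {- int m..int m})"
          by auto
        moreover have "nat (int m + 1) = Suc m" "nat (1 + int m) = Suc m" by auto
        ultimately show ?case using Suc by simp
      qed simp
      also have "\<dots> \<le> 1 + 2" by simp
      also have "\<dots> \<le> exp (2 :: real)" by (rule exp_ge_add_one_self)
      finally show ?thesis .
    qed
    finally show ?thesis .
  qed
  have "real (card {z \<in> PiE {..<n} (\<lambda>_. A). (\<Sum>i<n. (real_of_int (z i))\<^sup>2) \<le> s})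
      = (\<Sum>z | z \<in> PiE {..<n} (\<lambda>_. A) \<and> (\<Sum>i<n. (real_of_int (z i))\<^sup>2) \<le> s. 1)"
    by simp
  also have "\<dots> \<le> (\<Sum>z | z \<in> PiE {..<n} (\<lambda>_. A) \<and> (\<Sum>i<n. (real_of_int (z i))\<^sup>2) \<le> s.
      exp (s - (\<Sum>i<n. (real_of_int (z i))\<^sup>2)))"
    by (intro sum_mono) simp
  also have "\<dots> \<le> (\<Sum>z\<in>PiE {..<n} (\<lambda>_. A). exp (s - (\<Sum>i<n. (real_of_int (z i))\<^sup>2)))"
    using finP by (intro sum_mono2) auto
  also have "\<dots> = exp s * (\<Sum>z\<in>PiE {..<n} (\<lambda>_. A). \<Prod>i<n. exp (- (real_of_int (z i))\<^sup>2))"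
  proof -
    have "exp (s - (\<Sum>i<n. (real_of_int (z i))\<^sup>2)) = exp (s + (\<Sum>i<n. - (real_of_int (z i))\<^sup>2))" for z
      by (simp add: sum_negf)
    then show ?thesis by (simp only: exp_add exp_sum finite_lessThan sum_distrib_left)
  qed
  also have "(\<Sum>z\<in>PiE {..<n} (\<lambda>_. A). \<Prod>i<n. exp (- (real_of_int (z i))\<^sup>2))
      = (\<Prod>i<n. \<Sum>k\<in>A. exp (- (real_of_int k)\<^sup>2))"
    using assms by (intro prod_sum_PiE[symmetric]) auto
  also have "\<dots> \<le> (\<Prod>i<n. exp 2)"
    using geo by (intro prod_mono) (auto intro: sum_nonneg)
  also have "(\<Prod>i<n. exp 2) = exp (2 * real n)"
    by (simp add: exp_of_nat2_mult)
  finally show ?thesis by (simp add: exp_add)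
qed

lemma centered_form_eq_sum_pairs:
  "centered_form n p E (\<lambda>i j. z i * z j)
    = 2 * (\<Sum>e\<in>all_pairs n. (of_bool (e \<in> E) - p) * (\<Prod>k\<in>e. z k))"
proof -
  have "centered_form n p E (\<lambda>i j. z i * z j)
      = (\<Sum>i<n. \<Sum>j<n. if i \<noteq> j then (of_bool ({i, j} \<in> E) - p) * (\<Prod>k\<in>{i, j}. z k) else 0)"
    unfolding centered_form_def by (intro sum.cong refl) auto
  also have "\<dots> = 2 * (\<Sum>e\<in>all_pairs n. (of_bool (e \<in> E) - p) * (\<Prod>k\<in>e. z k))"
    by (rule sum_all_pairs[where f = "\<lambda>e. (of_bool (e \<in> E) - p) * (\<Prod>k\<in>e. z k)"])
  finally show ?thesis .
qed

lemma sum_pairs_prod_square_le: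
  fixes z :: "nat \<Rightarrow> real"
  shows "2 * (\<Sum>e\<in>all_pairs n. (\<Prod>k\<in>e. z k)\<^sup>2) \<le> (\<Sum>i<n. (z i)\<^sup>2)\<^sup>2"
proof -
  have "2 * (\<Sum>e\<in>all_pairs n. (\<Prod>k\<in>e. z k)\<^sup>2)
      = (\<Sum>i<n. \<Sum>j<n. if i \<noteq> j then (\<Prod>k\<in>{i, j}. z k)\<^sup>2 else 0)"
    by (rule sum_all_pairs[where f = "\<lambda>e. (\<Prod>k\<in>e. z k)\<^sup>2", symmetric])
  also have "\<dots> \<le> (\<Sum>i<n. \<Sum>j<n. (z i)\<^sup>2 * (z j)\<^sup>2)"
    by (intro sum_mono) (auto simp: power_mult_distrib)
  also have "\<dots> = (\<Sum>i<n. (z i)\<^sup>2)\<^sup>2"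
    by (simp add: power2_eq_square sum_product)
  finally show ?thesis .
qed

text \<open>Chernoff's bound for one vector, with \<open>s\<close> choosing the tail. The limits
  \<open>4 * sqrt d\<close> and \<open>4 * real n\<close> leave room for rounding a capped vector to
  integers.\<close>

lemma centered_form_tail:
  fixes z :: "nat \<Rightarrow> real"
  assumes p: "0 \<le> p" "p \<le> 1" and d: "d = real n * p" "1 \<le> d"
    and z: "\<And>i. i < n \<Longrightarrow> (z i)\<^sup>2 \<le> 4 * sqrt d" "(\<Sum>i<n. (z i)\<^sup>2) \<le> 4 * real n"
    and s: "\<bar>s\<bar> = (1 :: real)"
  shows "gnp_prob n p (\<lambda>E. 80 * real n * sqrt d \<le> s * centered_form n p E (\<lambda>i j. z i * z j))
    \<le> exp (- (19 / 2) * real n)"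
proof -
  \<comment> \<open>The largest parameter for which the entry bound yields
    \<open>\<bar>c e\<bar> \<le> 1\<close>, as \<open>gnp_mgf\<close> requires. The threshold then
    contributes \<open>- 10 * n\<close> to the exponent and the variance at most
    \<open>n / 2\<close>.\<close>
  define l where "l = 1 / (8 * sqrt d)"
  have q: "0 < sqrt d" using d by simp
  have l: "0 < l" "l * (80 * real n * sqrt d) = 10 * real n" "l\<^sup>2 = 1 / (64 * d)"
    using q d(2) by (simp_all add: l_def power_divide power_mult_distrib)
  define c where "c = (\<lambda>e. 2 * l * s * (\<Prod>k\<in>e. z k))"
  have lam: "l * (s * centered_form n p E (\<lambda>i j. z i * z j)) = (\<Sum>e\<in>all_pairs n. (of_bool (e \<in> E) - p) * c e)" for E
    by (simp add: centered_form_eq_sum_pairs c_def sum_distrib_left ac_simps)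
  have "gnp_prob n p (\<lambda>E. 80 * real n * sqrt d \<le> s * centered_form n p E (\<lambda>i j. z i * z j))
      \<le> (\<Sum>E\<in>Pow (all_pairs n). gnp_weight n p E *
          (exp (- (10 * real n)) * exp (\<Sum>e\<in>all_pairs n. (of_bool (e \<in> E) - p) * c e)))"
  proof (rule gnp_prob_markov[OF p])
    fix E assume "80 * real n * sqrt d \<le> s * centered_form n p E (\<lambda>i j. z i * z j)"
    then have "l * (80 * real n * sqrt d) \<le> l * (s * centered_form n p E (\<lambda>i j. z i * z j))"
      using l(1) by (intro mult_left_mono) auto
    then have "10 * real n \<le> (\<Sum>e\<in>all_pairs n. (of_bool (e \<in> E) - p) * c e)"
      by (simp only: lam l(2))
    then show "1 \<le> exp (- (10 * real n)) * exp (\<Sum>e\<in>all_pairs n. (of_bool (e \<in> E) - p) * c e)"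
      by (simp add: exp_add[symmetric])
  qed simp
  also have "\<dots> = exp (- (10 * real n)) * (\<Sum>E\<in>Pow (all_pairs n). gnp_weight n p E *
          exp (\<Sum>e\<in>all_pairs n. (of_bool (e \<in> E) - p) * c e))"
    by (simp add: sum_distrib_left ac_simps)
  also have "\<dots> \<le> exp (- (10 * real n)) * exp (p * (\<Sum>e\<in>all_pairs n. (c e)\<^sup>2))"
  proof (intro mult_left_mono gnp_mgf[OF p])
    fix e assume "e \<in> all_pairs n"
    then obtain i j where ij: "i < j" "j < n" "e = {i, j}" by (auto simp: all_pairs_def)
    have "(\<Prod>k\<in>e. z k)\<^sup>2 = (z i)\<^sup>2 * (z j)\<^sup>2" using ij by (simp add: power_mult_distrib)
    also have "\<dots> \<le> (4 * sqrt d) * (4 * sqrt d)"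
      using ij z(1) q by (intro mult_mono) auto
    finally have "\<bar>\<Prod>k\<in>e. z k\<bar>\<^sup>2 \<le> (4 * sqrt d)\<^sup>2"
      unfolding power2_abs by (simp only: power2_eq_square)
    then have "\<bar>\<Prod>k\<in>e. z k\<bar> \<le> 4 * sqrt d"
      by (rule power2_le_imp_le) (use q in simp)
    moreover have "\<bar>c e\<bar> = 2 * l * \<bar>\<Prod>k\<in>e. z k\<bar>"
      using l(1) s by (simp add: c_def abs_mult)
    ultimately have "\<bar>c e\<bar> \<le> 2 * l * (4 * sqrt d)"
      using l(1) by simp
    then show "\<bar>c e\<bar> \<le> 1" using q by (simp add: l_def)
  qed simp
  also have "\<dots> \<le> exp (- (10 * real n)) * exp (real n / 2)"
  proof -
    have "s\<^sup>2 = 1" using s by (metis one_power2 power2_abs)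
    then have "(\<Sum>e\<in>all_pairs n. (c e)\<^sup>2) = 2 * l\<^sup>2 * (2 * (\<Sum>e\<in>all_pairs n. (\<Prod>k\<in>e. z k)\<^sup>2))"
      by (simp add: c_def power_mult_distrib sum_distrib_left mult.assoc)
    also have "\<dots> \<le> 2 * l\<^sup>2 * ((\<Sum>i<n. (z i)\<^sup>2)\<^sup>2)"
      by (intro mult_left_mono sum_pairs_prod_square_le) simp
    also have "\<dots> \<le> 2 * l\<^sup>2 * ((4 * real n)\<^sup>2)"
      using z(2) by (intro mult_left_mono power_mono) (auto intro: sum_nonneg)
    finally have "p * (\<Sum>e\<in>all_pairs n. (c e)\<^sup>2) \<le> p * (2 * (1 / (64 * d)) * (4 * real n)\<^sup>2)"
      unfolding l(3) using p(1) by (rule mult_left_mono)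
    also have "\<dots> = (real n * p) * real n / (2 * d)"
      by (simp add: power2_eq_square)
    also have "\<dots> = real n / 2" using d by (simp only: d(1)[symmetric]) simp
    finally show ?thesis by simp
  qed
  also have "\<dots> = exp (- (19 / 2) * real n)"
    by (simp add: exp_add[symmetric])
  finally show ?thesis .
qed

text \<open>At squared length \<open>n\<close> the integer lattice is already a fine enough net:
  rounding alters the squared length by a constant factor only. There are at most
  \<open>exp (6 * n)\<close> integer vectors, two signs cost at most \<open>exp n\<close>, and each
  tail is \<open>exp (- 19 / 2 * n)\<close>.\<close>

lemma centered_form_bounded_box:
  assumes p: "0 \<le> p" "p \<le> 1" and d: "d = real n * p" "1 \<le> d"
  shows "gnp_prob n p (\<lambda>E. \<exists>z. (\<forall>i<n. (z i)\<^sup>2 \<le> sqrt d) \<and> (\<Sum>i<n. (z i)\<^sup>2) \<le> real n \<and>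
      80 * real n * sqrt d < \<bar>centered_form n p E (\<lambda>i j. z i * z j)\<bar>) \<le> exp (- real n)"
proof -
  define K where "K = 80 * real n * sqrt d"
  define R where "R = sqrt (sqrt d)"
  \<comment> \<open>A finite range holding every rounded entry; its size does not influence the
    count.\<close>
  define A where "A = {- \<lceil>2 * R\<rceil>..\<lceil>2 * R\<rceil>}"
  define Z where "Z = {w \<in> PiE {..<n} (\<lambda>_. A). (\<Sum>i<n. (real_of_int (w i))\<^sup>2) \<le> 4 * real n}"
  define Z' where "Z' = {w \<in> Z. \<forall>i<n. (real_of_int (w i))\<^sup>2 \<le> 4 * sqrt d}"
  define I where "I = Z' \<times> {1, - 1 :: real}"
  have R: "1 \<le> R" "R\<^sup>2 = sqrt d" using d by (simp_all add: R_def)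
  have n: "0 < n" using d by (cases n) auto
  have finZ: "finite Z"
    unfolding Z_def by (intro finite_subset[OF _ finite_PiE[of "{..<n}" "\<lambda>_. A"]]) (auto simp: A_def)
  have finI: "finite I" unfolding I_def Z'_def using finZ by auto
  have "gnp_prob n p (\<lambda>E. \<exists>z. (\<forall>i<n. (z i)\<^sup>2 \<le> sqrt d) \<and> (\<Sum>i<n. (z i)\<^sup>2) \<le> real n \<and>
      80 * real n * sqrt d < \<bar>centered_form n p E (\<lambda>i j. z i * z j)\<bar>)
     \<le> gnp_prob n p (\<lambda>E. \<exists>x\<in>I. K \<le> snd x *
          centered_form n p E (\<lambda>i j. real_of_int (fst x i) * real_of_int (fst x j)))"
  proof (rule gnp_prob_mono[OF p])
    fix E assume "\<exists>z. (\<forall>i<n. (z i)\<^sup>2 \<le> sqrt d) \<and> (\<Sum>i<n. (z i)\<^sup>2) \<le> real n \<and>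
      80 * real n * sqrt d < \<bar>centered_form n p E (\<lambda>i j. z i * z j)\<bar>"
    then obtain z where z: "\<And>i. i < n \<Longrightarrow> (z i)\<^sup>2 \<le> sqrt d" "(\<Sum>i<n. (z i)\<^sup>2) \<le> real n"
      "K < \<bar>centered_form n p E (\<lambda>i j. z i * z j)\<bar>" by (auto simp: K_def)
    obtain s :: real where s: "s = 1 \<or> s = -1" "K < s * centered_form n p E (\<lambda>i j. z i * z j)"
    proof (cases "0 \<le> centered_form n p E (\<lambda>i j. z i * z j)")
      case True
      then show ?thesis using z(3) that[of 1] by simp
    next
      case False
      then show ?thesis using z(3) that[of "-1"] by simp
    qed
    show "\<exists>x\<in>I. K \<le> snd x * centered_form n p E (\<lambda>i j. real_of_int (fst x i) * real_of_int (fst x j))"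
    \<comment> \<open>If no integer vector exceeds the threshold, every rounding of \<open>z\<close>
      obeys it, and \<open>quad_form_round\<close> passes the bound on to \<open>z\<close>.\<close>
    proof (rule ccontr)
      assume none: "\<not> ?thesis"
      have small: "s * centered_form n p E (\<lambda>i j. y i * y j) \<le> K"
        if y: "\<And>i. i < n \<Longrightarrow> y i = of_int \<lfloor>z i\<rfloor> \<or> y i = of_int \<lceil>z i\<rceil>" for y
      proof -
        define w where "w = restrict (\<lambda>i. if y i = of_int \<lfloor>z i\<rfloor> then \<lfloor>z i\<rfloor> else \<lceil>z i\<rceil>) {..<n}"
        have w: "real_of_int (w i) = y i" if "i < n" for i
        proof (cases "y i = of_int \<lfloor>z i\<rfloor>")
          case True
          then have "w i = \<lfloor>z i\<rfloor>" using that by (simp add: w_def)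
          with True show ?thesis by simp
        next
          case False
          then have "w i = \<lceil>z i\<rceil>" using that by (simp add: w_def)
          with False y[OF that] show ?thesis by simp
        qed
        have yb: "\<bar>y i\<bar> \<le> \<bar>z i\<bar> + 1" if i: "i < n" for i
        proof -
          have key: "\<bar>y i\<bar> \<le> \<bar>z i\<bar> + 1" if "y i = a \<or> y i = b" "a \<le> z i" "z i < a + 1" "b - 1 < z i" "z i \<le> b"
            for a b :: real using that by linarith
          show ?thesis
            by (rule key[OF y[OF i] of_int_floor_le floor_correct[of "z i", THEN conjunct2, simplified of_int_add of_int_1]
                ceiling_correct[of "z i", THEN conjunct1] ceiling_correct[of "z i", THEN conjunct2]])
        qed
        have zR: "\<bar>z i\<bar> \<le> R" if "i < n" for i
        proof (rule power2_le_imp_le)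
          show "\<bar>z i\<bar>\<^sup>2 \<le> R\<^sup>2" unfolding power2_abs R(2) by (rule z(1)[OF that])
          show "0 \<le> R" using R(1) by simp
        qed
        \<comment> \<open>Here \<open>1 \<le> R\<close> absorbs the rounding error, which is where
          \<open>1 \<le> d\<close> enters.\<close>
        have yR: "\<bar>y i\<bar> \<le> 2 * R" if "i < n" for i
          using yb[OF that] zR[OF that] R(1) by linarith
        have y2: "(y i)\<^sup>2 \<le> 4 * sqrt d" if "i < n" for i
        proof -
          have "\<bar>y i\<bar>\<^sup>2 \<le> (2 * R)\<^sup>2" by (rule power_mono[OF yR[OF that] abs_ge_zero])
          then show ?thesis by (simp add: power_mult_distrib R(2))
        qed
        have ys: "(y i)\<^sup>2 \<le> 2 * (z i)\<^sup>2 + 2" if "i < n" for i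
        proof -
          have "\<bar>y i\<bar>\<^sup>2 \<le> (\<bar>z i\<bar> + 1)\<^sup>2" by (rule power_mono[OF yb[OF that] abs_ge_zero])
          also have "(t + 1)\<^sup>2 \<le> 2 * t\<^sup>2 + 2" for t :: real
            using zero_le_power2[of "t - 1"] by (simp add: power2_eq_square algebra_simps)
          finally show ?thesis by simp
        qed
        have "(\<Sum>i<n. (y i)\<^sup>2) \<le> (\<Sum>i<n. 2 * (z i)\<^sup>2 + 2)"
          by (intro sum_mono ys) simp
        also have "\<dots> = 2 * (\<Sum>i<n. (z i)\<^sup>2) + 2 * real n"
          by (simp add: sum.distrib sum_distrib_left)
        also have "\<dots> \<le> 4 * real n" using z(2) by simp
        finally have "(\<Sum>i<n. (y i)\<^sup>2) \<le> 4 * real n" .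
        moreover have "w i \<in> A" if "i < n" for i
        proof -
          have "real_of_int \<bar>w i\<bar> \<le> 2 * R" using yR[OF that] w[OF that] by simp
          also have "\<dots> \<le> real_of_int \<lceil>2 * R\<rceil>" by (rule le_of_int_ceiling)
          finally have "\<bar>w i\<bar> \<le> \<lceil>2 * R\<rceil>" unfolding of_int_le_iff .
          then show ?thesis
            unfolding A_def atLeastAtMost_iff abs_le_iff minus_le_iff[of "w i"] by blast
        qed
        then have "w \<in> PiE {..<n} (\<lambda>_. A)"
          by (intro PiE_I) (simp_all add: w_def)
        moreover have "(\<Sum>i<n. (real_of_int (w i))\<^sup>2) = (\<Sum>i<n. (y i)\<^sup>2)"
          using w by (intro sum.cong) simp_all
        moreover have "\<forall>i<n. (real_of_int (w i))\<^sup>2 \<le> 4 * sqrt d"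
          using w y2 by simp
        ultimately have "w \<in> Z'"
          unfolding Z'_def Z_def by simp
        then have "(w, s) \<in> I" using s(1) by (auto simp: I_def)
        with none have "\<not> K \<le> snd (w, s) * centered_form n p E (\<lambda>i j. real_of_int (fst (w, s) i) * real_of_int (fst (w, s) j))"
          by blast
        then have "\<not> K \<le> s * centered_form n p E (\<lambda>i j. real_of_int (w i) * real_of_int (w j))"
          by simp
        moreover have "centered_form n p E (\<lambda>i j. real_of_int (w i) * real_of_int (w j))
            = centered_form n p E (\<lambda>i j. y i * y j)"
          unfolding centered_form_def using w by (intro sum.cong refl) auto
        ultimately show ?thesis by simp
      qed
      define M where "M = (\<lambda>i j. s * (if i \<noteq> j then of_bool ({i, j} \<in> E) - p else 0))"
      have M: "s * centered_form n p E (\<lambda>i j. y i * y j) = (\<Sum>i<n. \<Sum>j<n. M i j * (y i * y j))" for y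
        unfolding centered_form_def M_def sum_distrib_left by (simp only: mult.assoc)
      have "(\<Sum>i<n. \<Sum>j<n. M i j * (z i * z j)) \<le> K"
      proof (rule quad_form_round)
        show "M i i = 0" for i by (simp add: M_def)
        show "(\<Sum>i<n. \<Sum>j<n. M i j * (y i * y j)) \<le> K"
          if "\<And>i. i < n \<Longrightarrow> y i = of_int \<lfloor>z i\<rfloor> \<or> y i = of_int \<lceil>z i\<rceil>" for y
          using small[of y] that unfolding M by blast
      qed
      with s(2) show False unfolding M by simp
    qed
  qed
  also have "\<dots> \<le> (\<Sum>x\<in>I. gnp_prob n p (\<lambda>E. K \<le> snd x *
          centered_form n p E (\<lambda>i j. real_of_int (fst x i) * real_of_int (fst x j))))"
    by (rule gnp_prob_union_bound[OF p finI])
  also have "\<dots> \<le> (\<Sum>x\<in>I. exp (- (19 / 2) * real n))"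
    unfolding K_def by (intro sum_mono centered_form_tail[OF p d]) (auto simp: I_def Z'_def Z_def)
  also have "\<dots> = 2 * real (card Z') * exp (- (19 / 2) * real n)"
    by (simp add: I_def card_cartesian_product)
  also have "\<dots> \<le> 2 * exp (4 * real n + 2 * real n) * exp (- (19 / 2) * real n)"
  proof -
    have "real (card Z') \<le> real (card Z)"
      using finZ by (intro of_nat_mono card_mono) (auto simp: Z'_def)
    also have "\<dots> \<le> exp (4 * real n + 2 * real n)"
      unfolding Z_def by (rule card_int_vectors_le) (simp add: A_def)
    finally show ?thesis by simp
  qed
  also have "\<dots> \<le> exp (real n) * exp (4 * real n + 2 * real n) * exp (- (19 / 2) * real n)"
  proof -
    have "2 \<le> 1 + real n" using n by simp
    also have "\<dots> \<le> exp (real n)" by (rule exp_ge_add_one_self)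
    finally show ?thesis by (intro mult_right_mono) auto
  qed
  also have "\<dots> = exp (- (5 / 2) * real n)"
    by (simp add: exp_add[symmetric])
  also have "\<dots> \<le> exp (- real n)" by simp
  finally show ?thesis .
qed

text \<open>Rescaling extends the bound to vectors that violate the norm constraint.\<close>

lemma centered_form_bounded_extend:
  fixes z :: "nat \<Rightarrow> real"
  assumes n: "0 < n"
    and bd: "\<And>z. (\<And>i. i < n \<Longrightarrow> (z i)\<^sup>2 \<le> r) \<Longrightarrow> (\<Sum>i<n. (z i)\<^sup>2) \<le> real n \<Longrightarrow>
      \<bar>centered_form n p E (\<lambda>i j. z i * z j)\<bar> \<le> c * real n"
    and c: "0 \<le> c" and z: "\<And>i. i < n \<Longrightarrow> (z i)\<^sup>2 \<le> r"
  shows "\<bar>centered_form n p E (\<lambda>i j. z i * z j)\<bar> \<le> c * (real n + (\<Sum>i<n. (z i)\<^sup>2))"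
proof (cases "(\<Sum>i<n. (z i)\<^sup>2) \<le> real n")
  case True
  have "c * real n \<le> c * (real n + (\<Sum>i<n. (z i)\<^sup>2))"
    using c by (intro mult_left_mono) (auto intro: sum_nonneg)
  with bd[OF z True] show ?thesis by simp
next
  case False
  define S where "S = (\<Sum>i<n. (z i)\<^sup>2)"
  have S: "real n < S" "0 < S" using False n by (auto simp: S_def)
  \<comment> \<open>Scaling down to squared length \<open>n\<close> keeps the entry cap because
    \<open>t \<le> 1\<close>, and multiplies the form by \<open>n / S\<close>.\<close>
  define t where "t = sqrt (real n / S)"
  have t2: "t\<^sup>2 = real n / S" using S by (simp add: t_def)
  define y where "y = (\<lambda>i. t * z i)"
  have "\<bar>centered_form n p E (\<lambda>i j. y i * y j)\<bar> \<le> c * real n"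
  proof (rule bd)
    show "(y i)\<^sup>2 \<le> r" if "i < n" for i
    proof -
      have "(y i)\<^sup>2 = (real n / S) * (z i)\<^sup>2" by (simp add: y_def power_mult_distrib t2)
      also have "\<dots> \<le> 1 * (z i)\<^sup>2" using S by (intro mult_right_mono) auto
      finally show ?thesis using z[OF that] by simp
    qed
    have "(\<Sum>i<n. (y i)\<^sup>2) = (real n / S) * S"
      by (simp add: y_def power_mult_distrib t2 S_def sum_distrib_left)
    then show "(\<Sum>i<n. (y i)\<^sup>2) \<le> real n" using S by simp
  qed
  moreover have "centered_form n p E (\<lambda>i j. y i * y j) = (real n / S) * centered_form n p E (\<lambda>i j. z i * z j)"
    unfolding t2[symmetric]
    by (simp add: centered_form_def y_def sum_distrib_left power2_eq_square ac_simps)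
  ultimately have "(real n / S) * \<bar>centered_form n p E (\<lambda>i j. z i * z j)\<bar> \<le> c * real n"
    using S by (simp add: abs_mult)
  then have "\<bar>centered_form n p E (\<lambda>i j. z i * z j)\<bar> \<le> c * S"
    using S n by (simp add: field_simps)
  also have "\<dots> \<le> c * (real n + S)" using c by (intro mult_left_mono) auto
  finally show ?thesis by (simp add: S_def)
qed

section \<open>Local sparsity\<close>

definition induced_edges :: "nat set set \<Rightarrow> nat set \<Rightarrow> nat set set" where
  "induced_edges E H = {e \<in> E. e \<subseteq> H}"

text \<open>Handshaking inside \<open>H\<close>: each induced edge is seen from both ends.\<close>

lemma card_induced_edges:
  assumes "E \<subseteq> all_pairs n" "H \<subseteq> {..<n}"
  shows "2 * real (card (induced_edges E H)) = (\<Sum>i\<in>H. real (card {j \<in> H. {i, j} \<in> E}))"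
proof -
  have "2 * real (card (induced_edges E H)) = 2 * (\<Sum>e\<in>all_pairs n. of_bool (e \<in> induced_edges E H))"
  proof -
    have "all_pairs n \<inter> {e. e \<in> induced_edges E H} = induced_edges E H"
      using assms by (auto simp: induced_edges_def)
    then show ?thesis by (simp add: sum_of_bool_eq)
  qed
  also have "\<dots> = (\<Sum>i<n. \<Sum>j<n. if i \<noteq> j then of_bool ({i, j} \<in> induced_edges E H) else 0)"
    by (rule sum_all_pairs[where f = "\<lambda>e. of_bool (e \<in> induced_edges E H)", symmetric])
  also have "\<dots> = (\<Sum>i\<in>H. \<Sum>j\<in>H. if i \<noteq> j then of_bool ({i, j} \<in> induced_edges E H) else 0)"
  proof -
    have "(\<Sum>i<n. \<Sum>j<n. if i \<noteq> j then of_bool ({i, j} \<in> induced_edges E H) else (0 :: real))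
        = (\<Sum>i\<in>H. \<Sum>j<n. if i \<noteq> j then of_bool ({i, j} \<in> induced_edges E H) else 0)"
      by (rule sum.mono_neutral_right) (use assms in \<open>auto simp: induced_edges_def intro!: sum.neutral\<close>)
    also have "\<dots> = (\<Sum>i\<in>H. \<Sum>j\<in>H. if i \<noteq> j then of_bool ({i, j} \<in> induced_edges E H) else 0)"
      by (intro sum.cong refl sum.mono_neutral_right) (use assms in \<open>auto simp: induced_edges_def\<close>)
    finally show ?thesis .
  qed
  also have "\<dots> = (\<Sum>i\<in>H. real (card {j \<in> H. {i, j} \<in> E}))"
  proof (rule sum.cong[OF refl])
    fix i assume i: "i \<in> H"
    have fin: "finite H" using assms(2) by (rule finite_subset) simp
    have "(\<Sum>j\<in>H. if i \<noteq> j then of_bool ({i, j} \<in> induced_edges E H) else 0)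
        = (\<Sum>j\<in>H. of_bool ({i, j} \<in> E) :: real)"
    proof (rule sum.cong[OF refl])
      fix j assume "j \<in> H"
      moreover have "{i, i} \<notin> E" using assms(1) in_all_pairs_iff[of i i n] by blast
      ultimately show "(if i \<noteq> j then of_bool ({i, j} \<in> induced_edges E H) else 0)
          = (of_bool ({i, j} \<in> E) :: real)"
        using i by (auto simp: induced_edges_def)
    qed
    also have "\<dots> = real (card {j \<in> H. {i, j} \<in> E})"
      using fin by (simp add: sum_of_bool_eq Int_def)
    finally show "(\<Sum>j\<in>H. if i \<noteq> j then of_bool ({i, j} \<in> induced_edges E H) else 0)
        = real (card {j \<in> H. {i, j} \<in> E})" .
  qed
  finally show ?thesis .
qed

text \<open>Some vertex has at most the average degree, hence fewer than \<open>k\<close>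
  neighbours. It is removed, the rest is coloured by induction, since the density bound passes to
  subsets, and a free colour remains for it.\<close>

lemma degenerate_coloring:
  assumes E: "E \<subseteq> all_pairs n" and "H \<subseteq> {..<n}" and K: "K < real k"
    and "\<And>H'. H' \<subseteq> H \<Longrightarrow> H' \<noteq> {} \<Longrightarrow> 2 * real (card (induced_edges E H')) \<le> K * real (card H')"
  shows "\<exists>f. (\<forall>i\<in>H. f i < k) \<and> (\<forall>i\<in>H. \<forall>j\<in>H. {i, j} \<in> E \<longrightarrow> f i \<noteq> f j)"
  using assms(2,4)
proof (induction "card H" arbitrary: H)
  case 0
  then have "H = {}" by (metis card_0_eq finite_lessThan finite_subset)
  then show ?case by simp
next
  case (Suc m)
  have fin: "finite H" using Suc.prems(1) by (rule finite_subset) simp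
  have ne: "H \<noteq> {}" using Suc.hyps(2) by auto
  have "\<exists>v\<in>H. real (card {j \<in> H. {v, j} \<in> E}) \<le> K"
  proof (rule ccontr)
    assume "\<not> ?thesis"
    then have "(\<Sum>v\<in>H. K) < (\<Sum>v\<in>H. real (card {j \<in> H. {v, j} \<in> E}))"
      using fin ne by (intro sum_strict_mono) auto
    also have "\<dots> = 2 * real (card (induced_edges E H))"
      by (rule card_induced_edges[OF E Suc.prems(1), symmetric])
    also have "\<dots> \<le> K * real (card H)" by (rule Suc.prems(2)[OF order.refl ne])
    finally show False by (simp add: mult.commute)
  qed
  then obtain v where v: "v \<in> H" "card {j \<in> H. {v, j} \<in> E} < k" using K by force
  have "\<exists>f. (\<forall>i\<in>H - {v}. f i < k) \<and> (\<forall>i\<in>H - {v}. \<forall>j\<in>H - {v}. {i, j} \<in> E \<longrightarrow> f i \<noteq> f j)"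
  proof (rule Suc.hyps(1))
    show "m = card (H - {v})" using Suc.hyps(2) v fin by simp
    show "H - {v} \<subseteq> {..<n}" using Suc.prems(1) by blast
    show "2 * real (card (induced_edges E H')) \<le> K * real (card H')" if "H' \<subseteq> H - {v}" "H' \<noteq> {}" for H'
      using that by (intro Suc.prems(2)) auto
  qed
  then obtain f where f: "\<And>i. i \<in> H - {v} \<Longrightarrow> f i < k"
    "\<And>i j. i \<in> H - {v} \<Longrightarrow> j \<in> H - {v} \<Longrightarrow> {i, j} \<in> E \<Longrightarrow> f i \<noteq> f j" by blast
  have "card (f ` {j \<in> H. {v, j} \<in> E}) < card {..<k}"
    using card_image_le[of "{j \<in> H. {v, j} \<in> E}" f] fin v(2) by simp
  then have "\<not> {..<k} \<subseteq> f ` {j \<in> H. {v, j} \<in> E}"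
    using fin card_mono[of "f ` {j \<in> H. {v, j} \<in> E}" "{..<k}"] by auto
  then obtain c where c: "c < k" "c \<notin> f ` {j \<in> H. {v, j} \<in> E}" by auto
  have noloop: "{v, v} \<notin> E" using E in_all_pairs_iff[of v v n] by blast
  have "(f(v := c)) i \<noteq> (f(v := c)) j" if ij: "i \<in> H" "j \<in> H" "{i, j} \<in> E" for i j
  proof -
    consider "i = v" "j = v" | "i = v" "j \<noteq> v" | "i \<noteq> v" "j = v" | "i \<noteq> v" "j \<noteq> v" by blast
    then show ?thesis
    proof cases
      case 1
      with noloop ij show ?thesis by simp
    next
      case 2
      with c ij show ?thesis by auto
    next
      case 3
      with c ij show ?thesis by (auto simp: insert_commute)
    next
      case 4
      with f(2)[of i j] ij show ?thesis by simp
    qed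
  qed
  moreover have "(f(v := c)) i < k" if "i \<in> H" for i
    using f(1)[of i] c that by simp
  ultimately show ?case by blast
qed

text \<open>A single term of the expansion of \<open>(1 + s / n) ^ n\<close>, which is at most
  \<open>exp s\<close>.\<close>

lemma binomial_le_exp:
  assumes "1 \<le> s" "s \<le> n"
  shows "real (n choose s) \<le> exp (real s) * (real n / real s) ^ s"
proof -
  define \<theta> where "\<theta> = real s / real n"
  have \<theta>: "0 < \<theta>" using assms by (simp add: \<theta>_def)
  have "real (n choose s) * \<theta> ^ s \<le> (\<Sum>k\<le>n. real (n choose k) * \<theta> ^ k * 1 ^ (n - k))"
    using assms(2) \<theta> member_le_sum[of s "{..n}" "\<lambda>k. real (n choose k) * \<theta> ^ k"] by simp
  also have "\<dots> = (\<theta> + 1) ^ n" by (simp only: binomial_ring)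
  also have "\<dots> \<le> exp \<theta> ^ n"
    using \<theta> exp_ge_add_one_self[of \<theta>] by (intro power_mono) (auto simp: add.commute)
  also have "\<dots> = exp (real s)"
    using assms by (simp add: exp_of_nat_mult[symmetric] \<theta>_def)
  finally have "real (n choose s) * \<theta> ^ s \<le> exp (real s)" .
  then have "real (n choose s) \<le> exp (real s) / \<theta> ^ s"
    using \<theta> by (simp add: field_simps)
  also have "\<dots> = exp (real s) * (real n / real s) ^ s"
    by (simp add: \<theta>_def power_divide)
  finally show ?thesis .
qed

text \<open>Markov's inequality for \<open>y\<close> to the power of the number of induced edges. A
  large \<open>y\<close> is intended: for small \<open>H\<close> the threshold lies far above the
  mean, where the tail is of Poisson type.\<close>

lemma induced_edges_tail:
  assumes p: "0 \<le> p" "p \<le> 1" and H: "H \<subseteq> {..<n}" and y: "1 \<le> y"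
  shows "gnp_prob n p (\<lambda>E. r \<le> real (card (induced_edges E H)))
     \<le> exp (p * y * (real (card H))\<^sup>2 / 2) * y powr (- r)"
proof -
  define f where "f = (\<lambda>e. if e \<subseteq> H then y else 1)"
  have "gnp_prob n p (\<lambda>E. r \<le> real (card (induced_edges E H)))
      \<le> (\<Sum>E\<in>Pow (all_pairs n). gnp_weight n p E * ((\<Prod>e\<in>E. f e) * y powr (- r)))"
  proof (rule gnp_prob_markov[OF p])
    fix E assume E: "E \<subseteq> all_pairs n"
    show "0 \<le> (\<Prod>e\<in>E. f e) * y powr (- r)"
      using y by (intro mult_nonneg_nonneg prod_nonneg) (auto simp: f_def)
    assume r: "r \<le> real (card (induced_edges E H))"
    have finE: "finite E" using E by (rule finite_subset) simp
    have "(\<Prod>e\<in>E. f e) = (\<Prod>e\<in>induced_edges E H. y)"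
      unfolding induced_edges_def f_def using finE by (simp add: prod.If_cases Int_def)
    also have "\<dots> = y powr real (card (induced_edges E H))"
      using y by (simp add: powr_realpow)
    finally have "(\<Prod>e\<in>E. f e) * y powr (- r) = y powr (real (card (induced_edges E H)) - r)"
      using y by (simp add: powr_add[symmetric])
    also have "1 \<le> \<dots>" using r y by (intro ge_one_powr_ge_zero) auto
    finally show "1 \<le> (\<Prod>e\<in>E. f e) * y powr (- r)" .
  qed
  also have "\<dots> = (\<Sum>E\<in>Pow (all_pairs n). gnp_weight n p E * (\<Prod>e\<in>E. f e) * (\<Prod>e\<in>all_pairs n - E. 1)) * y powr (- r)"
    by (simp add: sum_distrib_right mult.assoc)
  also have "\<dots> = (\<Prod>e\<in>all_pairs n. p * f e + (1 - p) * 1) * y powr (- r)"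
    by (simp only: gnp_expectation_prod)
  also have "\<dots> \<le> exp (p * y * (real (card H))\<^sup>2 / 2) * y powr (- r)"
  proof (rule mult_right_mono)
    have "(\<Prod>e\<in>all_pairs n. p * f e + (1 - p) * 1) \<le> (\<Prod>e\<in>all_pairs n. exp (p * y * of_bool (e \<subseteq> H)))"
    proof (rule prod_mono, intro conjI)
      fix e
      show "0 \<le> p * f e + (1 - p) * 1" using p y by (auto simp: f_def)
      show "p * f e + (1 - p) * 1 \<le> exp (p * y * of_bool (e \<subseteq> H))"
      proof (cases "e \<subseteq> H")
        case True
        have "p * y + (1 - p) \<le> 1 + p * y" using p by simp
        also have "\<dots> \<le> exp (p * y)" by (rule exp_ge_add_one_self)
        finally show ?thesis using True by (simp add: f_def)
      qed (simp add: f_def)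
    qed
    also have "\<dots> = exp (p * y * (\<Sum>e\<in>all_pairs n. of_bool (e \<subseteq> H)))"
      by (simp only: exp_sum[OF finite_all_pairs] sum_distrib_left)
    also have "\<dots> \<le> exp (p * y * ((real (card H))\<^sup>2 / 2))"
    proof -
      have fin: "finite H" using H by (rule finite_subset) simp
      have "2 * (\<Sum>e\<in>all_pairs n. of_bool (e \<subseteq> H) :: real)
          = (\<Sum>i<n. \<Sum>j<n. if i \<noteq> j then of_bool ({i, j} \<subseteq> H) else 0)"
        by (rule sum_all_pairs[where f = "\<lambda>e. of_bool (e \<subseteq> H)", symmetric])
      also have "\<dots> \<le> (\<Sum>i<n. \<Sum>j<n. of_bool (i \<in> H) * of_bool (j \<in> H))"
        by (intro sum_mono) auto
      also have "\<dots> = (\<Sum>i<n. of_bool (i \<in> H))\<^sup>2"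
        by (simp only: power2_eq_square sum_product)
      also have "(\<Sum>i<n. of_bool (i \<in> H) :: real) = real (card H)"
        using H by (simp add: sum_of_bool_eq Int_absorb1)
      finally have "(\<Sum>e\<in>all_pairs n. of_bool (e \<subseteq> H)) \<le> (real (card H))\<^sup>2 / 2" by simp
      then show ?thesis using p y by (simp only: exp_le_cancel_iff) (intro mult_left_mono, auto)
    qed
    finally show "(\<Prod>e\<in>all_pairs n. p * f e + (1 - p) * 1) \<le> exp (p * y * (real (card H))\<^sup>2 / 2)"
      by simp
  qed simp
  finally show ?thesis .
qed

text \<open>Union bound over the sets of each size. The tail at size \<open>s\<close> beats the
  number of sets, with a surplus of order \<open>1 / n\<close> that is geometrically small in
  \<open>s\<close>.\<close>

lemma sparse_subgraphs:
  assumes p: "0 \<le> p" "p \<le> 1" and d: "d = real n * p" "1 \<le> d"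
  shows "gnp_prob n p (\<lambda>E. \<exists>H\<subseteq>{..<n}. H \<noteq> {} \<and> real (card H) * sqrt d \<le> real n \<and>
      4 * sqrt d * real (card H) < real (card (induced_edges E H))) \<le> 1 / real n"
proof -
  define q where "q = sqrt d"
  have q: "1 \<le> q" "q\<^sup>2 = d" using d by (simp_all add: q_def)
  have n: "0 < n" using d by (cases n) auto
  have dn: "d \<le> real n" using d p by (simp add: mult_left_le)
  define SS where "SS = {s \<in> {1..n}. real s * q \<le> real n}"
  define HH where "HH = (\<lambda>s. {H. H \<subseteq> {..<n} \<and> card H = s})"
  have finHH: "finite (HH s)" for s unfolding HH_def by simp
  have tail: "gnp_prob n p (\<lambda>E. 4 * q * real s \<le> real (card (induced_edges E H)))
      \<le> exp (4 * q * real s * (ln (q * real s / real n) - 1))" if s: "s \<in> SS" and H: "H \<in> HH s" for s H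
  proof -
    have s1: "0 < real s" "q * real s \<le> real n" using s by (auto simp: SS_def mult.commute)
    \<comment> \<open>Chosen so that \<open>p * y * s^2 / 2\<close> equals the threshold
      \<open>4 * q * s\<close>. The factor 8 exceeds \<open>exp 2\<close>, which turns
      \<open>1 - ln y\<close> into at most \<open>ln (q * s / n) - 1\<close>.\<close>
    define y where "y = 8 * real n / (q * real s)"
    have qs: "0 < q * real s" using s1 q by simp
    have y8: "8 \<le> y" using s1 qs by (simp add: y_def field_simps)
    have "gnp_prob n p (\<lambda>E. 4 * q * real s \<le> real (card (induced_edges E H)))
        \<le> exp (p * y * (real (card H))\<^sup>2 / 2) * y powr (- (4 * q * real s))"
      using H y8 by (intro induced_edges_tail[OF p]) (auto simp: HH_def)
    also have "p * y * (real (card H))\<^sup>2 / 2 = 4 * q * real s"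
    proof -
      have "p * y * (real (card H))\<^sup>2 / 2 = 4 * (real n * p) * real s / q"
        using H s1 q by (simp add: HH_def y_def power2_eq_square field_simps)
      also have "\<dots> = 4 * q * real s" unfolding d(1)[symmetric] q(2)[symmetric]
        using q(1) by (simp only: power2_eq_square) simp
      finally show ?thesis .
    qed
    also have "exp (4 * q * real s) * y powr (- (4 * q * real s)) = exp (4 * q * real s * (1 - ln y))"
      using y8 by (simp add: powr_def exp_add[symmetric] algebra_simps)
    also have "\<dots> \<le> exp (4 * q * real s * (ln (q * real s / real n) - 1))"
    proof -
      have "exp 2 \<le> (8 :: real)"
      proof -
        have "exp (1 :: real) ^ 2 \<le> (272 / 100) ^ 2"
          using e_less_272 by (intro power_mono) auto
        moreover have "exp (1 :: real) ^ 2 = exp 2" using exp_of_nat_mult[of 2 "1 :: real"] by simp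
        ultimately show ?thesis by (simp add: power2_eq_square)
      qed
      then have "2 \<le> ln (8 :: real)" by (subst ln_ge_iff) auto
      moreover have "ln y = ln 8 - ln (q * real s / real n)"
      proof -
        have "y = 8 / (q * real s / real n)" by (simp add: y_def)
        moreover have "0 < q * real s / real n" using qs n by simp
        moreover have "ln (8 / u) = ln 8 - ln u" if "0 < u" for u :: real
          using that by (simp add: ln_div)
        ultimately show ?thesis by (simp only:)
      qed
      ultimately show ?thesis using s1 q by (simp only: exp_le_cancel_iff) (intro mult_left_mono, auto)
    qed
    finally show ?thesis .
  qed
  have count_bound: "real (n choose s) * exp (4 * q * real s * (ln (q * real s / real n) - 1)) \<le> (1 / real n) * (1 / 2) ^ s"
    if s: "s \<in> SS" for s
  proof -
    have s1: "1 \<le> s" "s \<le> n" "q * real s \<le> real n" using s by (auto simp: SS_def mult.commute)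
    define u where "u = q * real s / real n"
    have u: "0 < u" "u \<le> 1" using s1 q n by (auto simp: u_def)
    define a where "a = - ln u"
    have a: "0 \<le> a" using u by (simp add: a_def)
    have "real n / real s = q / u" using s1 q n by (simp add: u_def)
    also have "\<dots> = exp (ln q + a)" using q u by (simp add: a_def exp_diff)
    finally have ns: "real n / real s = exp (ln q + a)" .
    have "real (n choose s) \<le> exp (real s) * (real n / real s) ^ s"
      by (rule binomial_le_exp) (use s1 in auto)
    also have "\<dots> = exp (real s * (1 + ln q + a))"
      unfolding ns exp_of_nat_mult[symmetric] by (simp add: exp_add[symmetric] algebra_simps)
    finally have "real (n choose s) * exp (4 * q * real s * (ln u - 1))
        \<le> exp (real s * (1 + ln q + a)) * exp (4 * q * real s * (ln u - 1))"
      by (intro mult_right_mono) auto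
    also have "\<dots> = exp (real s * (1 + ln q + a - 4 * q * a - 4 * q))"
      by (simp add: a_def exp_add[symmetric] algebra_simps)
    \<comment> \<open>By \<open>ln q \<le> q - 1\<close> and \<open>1 \<le> q\<close>, the
      coefficient of \<open>s\<close> is at most \<open>- 2 * a - 2\<close>. One copy of
      \<open>- 2 * a\<close> is kept, since it becomes \<open>u^2\<close>.\<close>
    also have "\<dots> \<le> exp (- 2 * a - 2 * real s)"
    proof -
      have "ln q \<le> q - 1" using q by (intro ln_le_minus_one) auto
      moreover have "1 * a \<le> q * a" using q a by (intro mult_right_mono) auto
      ultimately have "1 + ln q + a - 4 * q * a - 4 * q \<le> - 2 * a - 2"
        using q a by (simp add: algebra_simps)
      then have "real s * (1 + ln q + a - 4 * q * a - 4 * q) \<le> real s * (- 2 * a - 2)"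
        by (intro mult_left_mono) auto
      also have "\<dots> \<le> - 2 * a - 2 * real s"
        using mult_right_mono[of 1 "real s" a] s1 a by (simp add: algebra_simps)
      finally show ?thesis by simp
    qed
    also have "\<dots> = u\<^sup>2 * exp (- 2 * real s)"
    proof -
      have "exp (- 2 * a) = exp (ln u) * exp (ln u)" by (simp add: a_def exp_add[symmetric])
      then show ?thesis using u by (simp add: exp_diff exp_minus power2_eq_square divide_inverse)
    qed
    \<comment> \<open>The origin of the \<open>1 / n\<close> in the failure probability:
      \<open>u^2 = d * s^2 / n^2\<close> and \<open>d \<le> n\<close>.\<close>
    also have "\<dots> \<le> ((real s)\<^sup>2 / real n) * exp (- 2 * real s)"
    proof (rule mult_right_mono)
      have "u\<^sup>2 = d * (real s)\<^sup>2 / (real n)\<^sup>2" using q by (simp add: u_def power_divide power_mult_distrib)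
      also have "\<dots> \<le> real n * (real s)\<^sup>2 / (real n)\<^sup>2"
        using dn by (intro divide_right_mono mult_right_mono) auto
      also have "\<dots> = (real s)\<^sup>2 / real n" using n by (simp add: power2_eq_square)
      finally show "u\<^sup>2 \<le> (real s)\<^sup>2 / real n" .
    qed simp
    also have "\<dots> = (1 / real n) * ((real s * exp (- real s / 2))\<^sup>2 * exp (- 1) ^ s)"
      by (simp add: power_mult_distrib exp_of_nat_mult[symmetric] exp_add[symmetric] power2_eq_square)
    also have "\<dots> \<le> (1 / real n) * (1\<^sup>2 * (1 / 2) ^ s)"
    proof (intro mult_left_mono mult_mono power_mono)
      have "real s \<le> 1 + real s / 2 + (real s / 2)\<^sup>2 / 2"
        using zero_le_power2[of "real s / 2 - 1"] by (simp add: power2_eq_square algebra_simps)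
      also have "\<dots> \<le> exp (real s / 2)" by (rule exp_lower_Taylor_quadratic) simp
      finally show "real s * exp (- real s / 2) \<le> 1"
        by (simp add: exp_minus field_simps)
      show "exp (- 1) \<le> (1 / 2 :: real)"
        using exp_ge_add_one_self[of 1] by (simp add: exp_minus field_simps)
    qed auto
    finally show ?thesis by (simp add: u_def)
  qed
  have "gnp_prob n p (\<lambda>E. \<exists>H\<subseteq>{..<n}. H \<noteq> {} \<and> real (card H) * sqrt d \<le> real n \<and>
      4 * sqrt d * real (card H) < real (card (induced_edges E H)))
    \<le> gnp_prob n p (\<lambda>E. \<exists>s\<in>SS. \<exists>H\<in>HH s. 4 * q * real s \<le> real (card (induced_edges E H)))"
  proof (rule gnp_prob_mono[OF p])
    fix E assume "\<exists>H\<subseteq>{..<n}. H \<noteq> {} \<and> real (card H) * sqrt d \<le> real n \<and>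
      4 * sqrt d * real (card H) < real (card (induced_edges E H))"
    then obtain H where H: "H \<subseteq> {..<n}" "H \<noteq> {}" "real (card H) * q \<le> real n"
      "4 * q * real (card H) \<le> real (card (induced_edges E H))"
      unfolding q_def using less_imp_le by blast
    have "finite H" using H(1) by (rule finite_subset) simp
    then have "card H \<in> SS"
      using H card_mono[of "{..<n}" H] by (auto simp: SS_def Suc_le_eq card_gt_0_iff)
    moreover have "H \<in> HH (card H)" using H by (simp add: HH_def)
    ultimately show "\<exists>s\<in>SS. \<exists>H\<in>HH s. 4 * q * real s \<le> real (card (induced_edges E H))"
      using H(4) by blast
  qed
  also have "\<dots> \<le> (\<Sum>s\<in>SS. gnp_prob n p (\<lambda>E. \<exists>H\<in>HH s. 4 * q * real s \<le> real (card (induced_edges E H))))"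
    by (rule gnp_prob_union_bound[OF p]) (simp add: SS_def)
  also have "\<dots> \<le> (\<Sum>s\<in>SS. \<Sum>H\<in>HH s. gnp_prob n p (\<lambda>E. 4 * q * real s \<le> real (card (induced_edges E H))))"
    by (intro sum_mono gnp_prob_union_bound[OF p] finHH)
  also have "\<dots> \<le> (\<Sum>s\<in>SS. \<Sum>H\<in>HH s. exp (4 * q * real s * (ln (q * real s / real n) - 1)))"
    by (intro sum_mono tail)
  also have "\<dots> = (\<Sum>s\<in>SS. real (n choose s) * exp (4 * q * real s * (ln (q * real s / real n) - 1)))"
    by (simp add: HH_def n_subsets)
  also have "\<dots> \<le> (\<Sum>s\<in>SS. (1 / real n) * (1 / 2) ^ s)"
    by (intro sum_mono count_bound)
  also have "\<dots> \<le> (\<Sum>s\<in>{1..n}. (1 / real n) * (1 / 2) ^ s)"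
    by (intro sum_mono2) (auto simp: SS_def)
  also have "\<dots> = (1 / real n) * (\<Sum>s\<in>{1..n}. (1 / 2) ^ s)"
    by (simp add: sum_distrib_left)
  also have "\<dots> \<le> (1 / real n) * 1"
  proof (rule mult_left_mono)
    have "(\<Sum>s\<in>{1..n}. (1 / 2) ^ s) = 1 - (1 / 2 :: real) ^ n" by (induction n) auto
    then show "(\<Sum>s\<in>{1..n}. (1 / 2) ^ s) \<le> (1 :: real)" by simp
  qed simp
  finally show ?thesis by simp
qed

section \<open>Bounds on the theta functions\<close>

definition bounded_form :: "nat \<Rightarrow> real \<Rightarrow> nat set set \<Rightarrow> bool" where
  "bounded_form n p E \<longleftrightarrow> (\<forall>z. (\<forall>i<n. (z i)\<^sup>2 \<le> sqrt (real n * p)) \<and> (\<Sum>i<n. (z i)\<^sup>2) \<le> real n \<longrightarrow>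
      \<bar>centered_form n p E (\<lambda>i j. z i * z j)\<bar> \<le> 80 * real n * sqrt (real n * p))"

definition locally_sparse :: "nat \<Rightarrow> real \<Rightarrow> nat set set \<Rightarrow> bool" where
  "locally_sparse n p E \<longleftrightarrow> (\<forall>H\<subseteq>{..<n}. H \<noteq> {} \<and> real (card H) * sqrt (real n * p) \<le> real n \<longrightarrow>
      real (card (induced_edges E H)) \<le> 4 * sqrt (real n * p) * real (card H))"

text \<open>Multiplying \<open>G\<close> by \<open>n / \<tau>\<close> turns the diagonal cap into
  \<open>q\<close> and the trace bound into \<open>n\<close>, so
  \<open>grothendieck_truncated\<close> applies with \<open>R = sqrt q\<close> and
  \<open>c = 80 * q\<close>.\<close>

lemma centered_form_psd_le:
  assumes bd: "bounded_form n p E" and q: "q = sqrt (real n * p)" "0 < q" and n: "0 < n"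
    and G: "psd n G" "\<And>i. i < n \<Longrightarrow> real n * G i i \<le> q * \<tau>" "(\<Sum>i<n. G i i) \<le> \<tau>" and \<tau>: "0 < \<tau>"
  shows "\<bar>centered_form n p E G\<bar> \<le> 2880 * q * \<tau>"
proof -
  define G' where "G' = (\<lambda>i j. sqrt (real n / \<tau>) * sqrt (real n / \<tau>) * G i j)"
  have G': "G' i j = (real n / \<tau>) * G i j" for i j
    using \<tau> by (simp add: G'_def)
  have "\<bar>\<Sum>i<n. \<Sum>j<n. (if i \<noteq> j then of_bool ({i, j} \<in> E) - p else 0) * G' i j\<bar>
      \<le> 36 * (80 * q) * real n"
  proof (rule grothendieck_truncated[where R = "sqrt q"])
    fix z :: "nat \<Rightarrow> real" assume z: "\<And>i. i < n \<Longrightarrow> \<bar>z i\<bar> \<le> sqrt q"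
    have "(z i)\<^sup>2 \<le> q" if "i < n" for i
      using power_mono[OF z[OF that], of 2] q(2) by simp
    moreover have "\<bar>centered_form n p E (\<lambda>i j. y i * y j)\<bar> \<le> 80 * q * real n"
      if "\<And>i. i < n \<Longrightarrow> (y i)\<^sup>2 \<le> q" "(\<Sum>i<n. (y i)\<^sup>2) \<le> real n" for y
      using bd that unfolding bounded_form_def q(1)[symmetric] by (simp add: ac_simps)
    ultimately show "\<bar>\<Sum>i<n. \<Sum>j<n. (if i \<noteq> j then of_bool ({i, j} \<in> E) - p else 0) * (z i * z j)\<bar>
        \<le> 80 * q * (real n + (\<Sum>i<n. (z i)\<^sup>2))"
      unfolding centered_form_def[symmetric] using n q(2)
      by (intro centered_form_bounded_extend[where r = q]) auto
  next
    show "psd n G'" unfolding G'_def by (rule psd_restrict[OF G(1)])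
    show "G' i i \<le> (sqrt q)\<^sup>2" if "i < n" for i
      using G(2)[OF that] q(2) \<tau> by (simp add: G' field_simps)
    have "(\<Sum>i<n. G' i i) = (real n / \<tau>) * (\<Sum>i<n. G i i)"
      by (simp only: G' sum_distrib_left)
    also have "\<dots> \<le> (real n / \<tau>) * \<tau>" using \<tau> by (intro mult_left_mono G(3)) simp
    finally show "(\<Sum>i<n. G' i i) \<le> real n" using \<tau> by simp
  qed (use q in auto)
  moreover have "(\<Sum>i<n. \<Sum>j<n. (if i \<noteq> j then of_bool ({i, j} \<in> E) - p else 0) * G' i j)
      = (real n / \<tau>) * centered_form n p E G"
    unfolding centered_form_def G' sum_distrib_left by (simp only: mult.left_commute)
  ultimately have "(real n / \<tau>) * \<bar>centered_form n p E G\<bar> \<le> (real n / \<tau>) * (2880 * q * \<tau>)"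
    using \<tau> by (simp add: abs_mult mult.commute)
  then show ?thesis
    using n \<tau> by (subst (asm) mult_le_cancel_left_pos) auto
qed

lemma sum_restrict_square:
  fixes G :: "nat \<Rightarrow> nat \<Rightarrow> real"
  assumes "H \<subseteq> {..<n}"
  shows "(\<Sum>i<n. \<Sum>j<n. of_bool (i \<in> H) * of_bool (j \<in> H) * G i j) = (\<Sum>i\<in>H. \<Sum>j\<in>H. G i j)"
proof -
  have "(\<Sum>i<n. \<Sum>j<n. of_bool (i \<in> H) * of_bool (j \<in> H) * G i j)
      = (\<Sum>i\<in>H. \<Sum>j<n. of_bool (i \<in> H) * of_bool (j \<in> H) * G i j)"
    by (rule sum.mono_neutral_right) (use assms in auto)
  also have "\<dots> = (\<Sum>i\<in>H. \<Sum>j\<in>H. of_bool (i \<in> H) * of_bool (j \<in> H) * G i j)"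
    by (intro sum.cong refl sum.mono_neutral_right) (use assms in auto)
  also have "\<dots> = (\<Sum>i\<in>H. \<Sum>j\<in>H. G i j)"
    by (intro sum.cong refl) auto
  finally show ?thesis .
qed

text \<open>For Gram vectors summing to \<open>x\<close> outside \<open>H\<close> and to
  \<open>y\<close> inside, this is |x + y|^2 \<le> 2 |x|^2 + 2 |y|^2. The test vector with entries
  +1 on \<open>H\<close> and -1 elsewhere supplies the missing |x - y|^2.\<close>

lemma psd_split:
  assumes "psd n D" "H \<subseteq> {..<n}"
  shows "(\<Sum>i<n. \<Sum>j<n. D i j)
    \<le> 2 * (\<Sum>i<n. \<Sum>j<n. of_bool (i \<notin> H) * of_bool (j \<notin> H) * D i j) + 2 * (\<Sum>i\<in>H. \<Sum>j\<in>H. D i j)"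
proof -
  define h where "h = (\<lambda>i. of_bool (i \<in> H) :: real)"
  have h: "of_bool (i \<notin> H) = 1 - h i" for i by (simp add: h_def)
  have "0 \<le> (\<Sum>i<n. \<Sum>j<n. (2 * h i - 1) * (2 * h j - 1) * D i j)"
    by (rule psd_quad[OF assms(1)])
  also have "\<dots> = (\<Sum>i<n. \<Sum>j<n. 2 * ((1 - h i) * (1 - h j) * D i j) + 2 * (h i * h j * D i j) - D i j)"
    by (intro sum.cong refl) (simp add: algebra_simps)
  also have "\<dots> = 2 * (\<Sum>i<n. \<Sum>j<n. (1 - h i) * (1 - h j) * D i j)
      + 2 * (\<Sum>i<n. \<Sum>j<n. h i * h j * D i j) - (\<Sum>i<n. \<Sum>j<n. D i j)"
    by (simp only: sum.distrib sum_subtractf sum_distrib_left)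
  also have "(\<Sum>i<n. \<Sum>j<n. h i * h j * D i j) = (\<Sum>i\<in>H. \<Sum>j\<in>H. D i j)"
    unfolding h_def by (rule sum_restrict_square[OF assms(2)])
  finally show ?thesis by (simp only: h)
qed

text \<open>At most \<open>n / q\<close> rows of a dual solution can have large diagonal entries;
  they are split off and bounded separately.\<close>

lemma dual_bound_light_heavy:
  assumes D: "psd n D" "\<And>i j. i < n \<Longrightarrow> j < n \<Longrightarrow> N i j \<Longrightarrow> D i j \<le> 0" and q: "0 < q"
    and light: "\<And>G \<tau>. psd n G \<Longrightarrow> (\<And>i j. i < n \<Longrightarrow> j < n \<Longrightarrow> N i j \<Longrightarrow> G i j \<le> 0) \<Longrightarrow>
      (\<And>i. i < n \<Longrightarrow> real n * G i i \<le> q * \<tau>) \<Longrightarrow> (\<Sum>i<n. G i i) \<le> \<tau> \<Longrightarrow> 0 < \<tau> \<Longrightarrow>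
      (\<Sum>i<n. \<Sum>j<n. G i j) \<le> \<alpha> * \<tau>"
    and heavy: "\<And>H. H \<subseteq> {..<n} \<Longrightarrow> real (card H) * q \<le> real n \<Longrightarrow>
      (\<Sum>i\<in>H. \<Sum>j\<in>H. D i j) \<le> \<beta> * (\<Sum>i\<in>H. D i i)" and \<beta>: "0 \<le> \<beta>"
  shows "(\<Sum>i<n. \<Sum>j<n. D i j) \<le> (2 * \<alpha> + 2 * \<beta>) * (\<Sum>i<n. D i i)"
proof (cases "(\<Sum>i<n. D i i) = 0")
  case True
  then show ?thesis using psd_sum_le[OF D(1), of "{..<n}"] by simp
next
  case False
  define \<tau> where "\<tau> = (\<Sum>i<n. D i i)"
  have diag: "0 \<le> D i i" if "i < n" for i using psd_diag_nonneg[OF D(1) that] .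
  have \<tau>: "0 < \<tau>" using False diag sum_nonneg[of "{..<n}" "\<lambda>i. D i i"] by (auto simp: \<tau>_def less_le)
  define H where "H = {i. i < n \<and> q * \<tau> < real n * D i i}"
  have H: "H \<subseteq> {..<n}" "finite H" by (auto simp: H_def)
  have trH: "(\<Sum>i\<in>H. D i i) \<le> \<tau>"
    unfolding \<tau>_def using H diag by (intro sum_mono2) auto
  have "real (card H) * (q * \<tau>) = (\<Sum>i\<in>H. q * \<tau>)" by simp
  also have "\<dots> \<le> (\<Sum>i\<in>H. real n * D i i)" by (intro sum_mono) (auto simp: H_def)
  also have "\<dots> \<le> real n * \<tau>" unfolding sum_distrib_left[symmetric] by (intro mult_left_mono trH) simp
  finally have "real (card H) * q \<le> real n" using \<tau> by (simp add: mult.assoc[symmetric])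
  then have "(\<Sum>i\<in>H. \<Sum>j\<in>H. D i j) \<le> \<beta> * (\<Sum>i\<in>H. D i i)" by (rule heavy[OF H(1)])
  also have "\<dots> \<le> \<beta> * \<tau>" by (intro mult_left_mono trH \<beta>)
  finally have hv: "(\<Sum>i\<in>H. \<Sum>j\<in>H. D i j) \<le> \<beta> * \<tau>" .
  \<comment> \<open>The cap is measured against the trace of all of \<open>D\<close>, hence the free
    parameter \<tau> in \<open>light\<close>: the trace of \<open>G\<close> may be smaller.\<close>
  define G where "G = (\<lambda>i j. of_bool (i \<notin> H) * of_bool (j \<notin> H) * D i j)"
  have "(\<Sum>i<n. \<Sum>j<n. G i j) \<le> \<alpha> * \<tau>"
  proof (rule light)
    show "psd n G" unfolding G_def by (rule psd_restrict[OF D(1)])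
    show "G i j \<le> 0" if "i < n" "j < n" "N i j" for i j
      using D(2)[OF that] by (simp add: G_def)
    show "real n * G i i \<le> q * \<tau>" if "i < n" for i
      using that q \<tau> by (auto simp: G_def H_def not_less)
    show "(\<Sum>i<n. G i i) \<le> \<tau>"
      unfolding \<tau>_def using diag by (intro sum_mono) (auto simp: G_def)
  qed (rule \<tau>)
  then show ?thesis
    using psd_split[OF D(1) H(1)] hv unfolding G_def \<tau>_def[symmetric] by (simp add: distrib_right)
qed

text \<open>Gram vectors are summed by colour class. Cauchy-Schwarz over the classes costs the
  factor \<open>k\<close>, and inside a class the nonpositive off-diagonal entries leave at most the
  trace.\<close>

lemma psd_sum_le_coloring:
  assumes D: "psd n D" and H: "H \<subseteq> {..<n}" and f: "\<And>i. i \<in> H \<Longrightarrow> f i < k"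
    and same: "\<And>i j. i \<in> H \<Longrightarrow> j \<in> H \<Longrightarrow> i \<noteq> j \<Longrightarrow> f i = f j \<Longrightarrow> D i j \<le> 0"
  shows "(\<Sum>i\<in>H. \<Sum>j\<in>H. D i j) \<le> real k * (\<Sum>i\<in>H. D i i)"
proof -
  have fin: "finite H" using H by (rule finite_subset) simp
  obtain v where v: "\<And>i j. i < n \<Longrightarrow> j < n \<Longrightarrow> ip n (v i) (v j) = D i j"
    using psd_gram_ex[OF D] by blast
  have gram: "(\<Sum>i\<in>A. \<Sum>j\<in>A. D i j) = (\<Sum>m<n. (\<Sum>i\<in>A. v i m)\<^sup>2)" if A: "A \<subseteq> H" for A
  proof -
    have "(\<Sum>i\<in>A. \<Sum>j\<in>A. D i j) = (\<Sum>i\<in>A. \<Sum>j\<in>A. \<Sum>m<n. v i m * v j m)"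
    proof (intro sum.cong refl)
      fix i j assume "i \<in> A" "j \<in> A"
      then have "i < n" "j < n" using A H by auto
      then show "D i j = (\<Sum>m<n. v i m * v j m)" using v[of i j] by (simp add: ip_def)
    qed
    also have "\<dots> = (\<Sum>i\<in>A. \<Sum>m<n. \<Sum>j\<in>A. v i m * v j m)"
      by (intro sum.cong refl sum.swap)
    also have "\<dots> = (\<Sum>m<n. \<Sum>i\<in>A. \<Sum>j\<in>A. v i m * v j m)"
      by (rule sum.swap)
    finally show ?thesis by (simp only: power2_eq_square sum_product)
  qed
  have group: "(\<Sum>a<k. \<Sum>i\<in>{x \<in> H. f x = a}. g i) = (\<Sum>i\<in>H. g i)" for g :: "nat \<Rightarrow> real"
    using fin f by (intro sum.group) auto
  have "(\<Sum>i\<in>H. \<Sum>j\<in>H. D i j) = (\<Sum>m<n. (\<Sum>a<k. \<Sum>i\<in>{x \<in> H. f x = a}. v i m)\<^sup>2)"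
    by (simp only: gram[OF order.refl] group)
  also have "\<dots> \<le> (\<Sum>m<n. real k * (\<Sum>a<k. (\<Sum>i\<in>{x \<in> H. f x = a}. v i m)\<^sup>2))"
    using sum_squared_le_sum_of_squares[where I = "{..<k}"] by (intro sum_mono) (simp add: mult.commute)
  also have "\<dots> = real k * (\<Sum>a<k. \<Sum>m<n. (\<Sum>i\<in>{x \<in> H. f x = a}. v i m)\<^sup>2)"
    by (subst sum.swap) (simp only: sum_distrib_left)
  also have "\<dots> = real k * (\<Sum>a<k. \<Sum>i\<in>{x \<in> H. f x = a}. \<Sum>j\<in>{x \<in> H. f x = a}. D i j)"
    by (subst gram) auto
  also have "\<dots> \<le> real k * (\<Sum>a<k. \<Sum>i\<in>{x \<in> H. f x = a}. D i i)"
  proof (intro mult_left_mono sum_mono)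
    fix a i assume i: "i \<in> {x \<in> H. f x = a}"
    have "(\<Sum>j\<in>{x \<in> H. f x = a}. D i j) = D i i + (\<Sum>j\<in>{x \<in> H. f x = a} - {i}. D i j)"
      using fin i by (intro sum.remove) auto
    also have "(\<Sum>j\<in>{x \<in> H. f x = a} - {i}. D i j) \<le> 0"
      using i by (intro sum_nonpos same) auto
    finally show "(\<Sum>j\<in>{x \<in> H. f x = a}. D i j) \<le> D i i" by simp
  qed simp
  finally show ?thesis by (simp only: group)
qed

lemma sum_offdiag:
  fixes G :: "nat \<Rightarrow> nat \<Rightarrow> real"
  shows "(\<Sum>i<n. \<Sum>j<n. (if i \<noteq> j then c else 0) * G i j) = c * ((\<Sum>i<n. \<Sum>j<n. G i j) - (\<Sum>i<n. G i i))"
proof -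
  have "(\<Sum>i<n. \<Sum>j<n. (if i \<noteq> j then c else 0) * G i j)
      = (\<Sum>i<n. \<Sum>j<n. c * G i j - (if i = j then c * G i i else 0))"
    by (intro sum.cong refl) auto
  then show ?thesis by (simp add: sum_subtractf sum_distrib_left right_diff_distrib)
qed

text \<open>Here \<open>G\<close> is nonpositive on \<open>E\<close>, so lowering the coefficient
  there from \<open>1 - p\<close> to \<open>- p\<close> can only increase the form. Dividing by
  \<open>p\<close> turns \<open>q\<close> into \<open>Q\<close>. Exceptional sets have at most
  \<open>n / q = Q\<close> elements, so the trivial bound handles them.\<close>

lemma theta_2_le:
  assumes bd: "bounded_form n p E" and p: "0 < p" "p \<le> 1 / 2" and np: "1 \<le> real n * p"
    and E: "E \<subseteq> all_pairs n"
  shows "theta_2 n E \<le> 5764 * sqrt (real n / p)"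
proof -
  define q where "q = sqrt (real n * p)"
  have n: "0 < n" using np by (cases n) auto
  have q: "1 \<le> q" "q * q = real n * p" using np by (simp_all add: q_def)
  define Q where "Q = sqrt (real n / p)"
  have Q: "Q * q = real n" "Q * p = q"
  proof -
    have "sqrt (real n / p) * sqrt (real n * p) = sqrt (real n * real n)"
      using p by (simp add: real_sqrt_mult[symmetric])
    then show *: "Q * q = real n" by (simp add: Q_def q_def)
    have "(Q * p) * q = q * q" using * q(2) by (simp add: mult.commute mult.left_commute)
    then show "Q * p = q" using q(1) by simp
  qed
  have Q1: "1 \<le> Q"
    unfolding Q_def using p n by (simp add: field_simps)
  have C: "compl_graph n E \<subseteq> all_pairs n" by (auto simp: compl_graph_def)
  have "theta_bar_2 n (compl_graph n E) \<le> 2 * (2881 * Q) + 2 * Q"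
  proof (rule theta_bar_2_le_dual[OF _ C])
    show "1 < 2 * (2881 * Q) + 2 * Q" using Q1 by simp
    fix D assume D: "psd n D" and D0: "\<And>i j. i < n \<Longrightarrow> j < n \<Longrightarrow> i \<noteq> j \<Longrightarrow> {i, j} \<notin> compl_graph n E \<Longrightarrow> D i j \<le> 0"
    show "(\<Sum>i<n. \<Sum>j<n. D i j) \<le> (2 * (2881 * Q) + 2 * Q) * (\<Sum>i<n. D i i)"
    proof (rule dual_bound_light_heavy[OF D, where N = "\<lambda>i j. {i, j} \<in> E" and q = q])
      show "D i j \<le> 0" if "i < n" "j < n" "{i, j} \<in> E" for i j
      proof (rule D0[OF that(1,2)])
        show "i \<noteq> j" using that E in_all_pairs_iff[of i j n] by auto
        show "{i, j} \<notin> compl_graph n E" using that by (simp add: compl_graph_def)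
      qed
      show "(\<Sum>i<n. \<Sum>j<n. G i j) \<le> 2881 * Q * \<tau>"
        if G: "psd n G" and G0: "\<And>i j. i < n \<Longrightarrow> j < n \<Longrightarrow> {i, j} \<in> E \<Longrightarrow> G i j \<le> 0"
          and Gq: "\<And>i. i < n \<Longrightarrow> real n * G i i \<le> q * \<tau>" and tr: "(\<Sum>i<n. G i i) \<le> \<tau>" and \<tau>: "0 < \<tau>"
        for G \<tau>
      proof -
        have cf: "\<bar>centered_form n p E G\<bar> \<le> 2880 * q * \<tau>"
          using q n by (intro centered_form_psd_le[OF bd q_def _ _ G Gq tr \<tau>]) auto
        have "centered_form n p E G \<le> (\<Sum>i<n. \<Sum>j<n. (if i \<noteq> j then - p else 0) * G i j)"
          unfolding centered_form_def
          by (intro sum_mono) (auto simp: left_diff_distrib intro: G0)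
        also have "\<dots> = - p * ((\<Sum>i<n. \<Sum>j<n. G i j) - (\<Sum>i<n. G i i))"
          by (rule sum_offdiag)
        finally have "p * (\<Sum>i<n. \<Sum>j<n. G i j) \<le> p * (\<Sum>i<n. G i i) + 2880 * q * \<tau>"
          using cf by (simp add: algebra_simps)
        also have "\<dots> \<le> p * \<tau> + 2880 * q * \<tau>"
          using p by (intro add_right_mono mult_left_mono tr) auto
        also have "\<dots> = p * (\<tau> + 2880 * Q * \<tau>)"
          unfolding Q(2)[symmetric] by (simp add: algebra_simps)
        finally have "(\<Sum>i<n. \<Sum>j<n. G i j) \<le> \<tau> + 2880 * Q * \<tau>"
          using p by simp
        also have "\<dots> \<le> Q * \<tau> + 2880 * Q * \<tau>"
          using Q1 \<tau> by simp
        finally show ?thesis by simp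
      qed
      show "(\<Sum>i\<in>H. \<Sum>j\<in>H. D i j) \<le> Q * (\<Sum>i\<in>H. D i i)"
        if H: "H \<subseteq> {..<n}" "real (card H) * q \<le> real n" for H
      proof -
        have "real (card H) * q \<le> Q * q" using H Q by simp
        then have "real (card H) \<le> Q" using q by simp
        then have "real (card H) * (\<Sum>i\<in>H. D i i) \<le> Q * (\<Sum>i\<in>H. D i i)"
          using psd_diag_nonneg[OF D] H by (intro mult_right_mono sum_nonneg) auto
        moreover have "finite H" using H(1) by (rule finite_subset) simp
        ultimately show ?thesis using psd_sum_le[OF D _ H(1)] by simp
      qed
    qed (use q Q1 in auto)
  qed
  then show ?thesis by (simp add: theta_2_def Q_def)
qed

text \<open>Here \<open>G\<close> is nonpositive off \<open>E\<close>, so raising the coefficient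
  there to \<open>1 - p\<close> can only decrease the form; \<open>1 - p \<ge> 1 / 2\<close> costs a
  factor 2. The size \<open>n / q\<close> of an exceptional set is too large a bound now, and
  colouring replaces it.\<close>

lemma theta_bar_2_le:
  assumes bd: "bounded_form n p E" and sparse: "locally_sparse n p E"
    and p: "0 < p" "p \<le> 1 / 2" and np: "1 \<le> real n * p" and E: "E \<subseteq> all_pairs n"
  shows "theta_bar_2 n E \<le> 11540 * sqrt (real n * p)"
proof -
  define q where "q = sqrt (real n * p)"
  have n: "0 < n" using np by (cases n) auto
  have q: "1 \<le> q" using np by (simp add: q_def)
  have "theta_bar_2 n E \<le> 2 * (5761 * q) + 2 * (9 * q)"
  proof (rule theta_bar_2_le_dual[OF _ E])
    show "1 < 2 * (5761 * q) + 2 * (9 * q)" using q by simp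
    fix D assume D: "psd n D" and D0: "\<And>i j. i < n \<Longrightarrow> j < n \<Longrightarrow> i \<noteq> j \<Longrightarrow> {i, j} \<notin> E \<Longrightarrow> D i j \<le> 0"
    show "(\<Sum>i<n. \<Sum>j<n. D i j) \<le> (2 * (5761 * q) + 2 * (9 * q)) * (\<Sum>i<n. D i i)"
    proof (rule dual_bound_light_heavy[OF D, where N = "\<lambda>i j. i \<noteq> j \<and> {i, j} \<notin> E" and q = q])
      show "D i j \<le> 0" if "i < n" "j < n" "i \<noteq> j \<and> {i, j} \<notin> E" for i j
        using D0 that by blast
      show "(\<Sum>i<n. \<Sum>j<n. G i j) \<le> 5761 * q * \<tau>"
        if G: "psd n G" and G0: "\<And>i j. i < n \<Longrightarrow> j < n \<Longrightarrow> i \<noteq> j \<and> {i, j} \<notin> E \<Longrightarrow> G i j \<le> 0"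
          and Gq: "\<And>i. i < n \<Longrightarrow> real n * G i i \<le> q * \<tau>" and tr: "(\<Sum>i<n. G i i) \<le> \<tau>" and \<tau>: "0 < \<tau>"
        for G \<tau>
      proof -
        have cf: "\<bar>centered_form n p E G\<bar> \<le> 2880 * q * \<tau>"
          using q n by (intro centered_form_psd_le[OF bd q_def _ _ G Gq tr \<tau>]) auto
        have "(1 - p) * ((\<Sum>i<n. \<Sum>j<n. G i j) - (\<Sum>i<n. G i i))
            = (\<Sum>i<n. \<Sum>j<n. (if i \<noteq> j then 1 - p else 0) * G i j)"
          by (rule sum_offdiag[symmetric])
        also have "\<dots> \<le> centered_form n p E G"
          unfolding centered_form_def
          by (intro sum_mono) (auto simp: left_diff_distrib intro: G0)
        finally have le: "(1 - p) * ((\<Sum>i<n. \<Sum>j<n. G i j) - (\<Sum>i<n. G i i)) \<le> 2880 * q * \<tau>"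
          using cf by simp
        have "(\<Sum>i<n. \<Sum>j<n. G i j) - (\<Sum>i<n. G i i) \<le> 2 * (2880 * q * \<tau>)"
        proof (rule ccontr)
          assume neg: "\<not> ?thesis"
          have pos: "0 < 2880 * q * \<tau>" using q \<tau> by simp
          have "(1 / 2) * (2 * (2880 * q * \<tau>)) < (1 - p) * ((\<Sum>i<n. \<Sum>j<n. G i j) - (\<Sum>i<n. G i i))"
            using neg pos p by (intro mult_le_less_imp_less) auto
          with le show False by simp
        qed
        moreover have "\<tau> \<le> q * \<tau>" using q \<tau> by simp
        ultimately show ?thesis using tr by (simp add: algebra_simps)
      qed
      show "(\<Sum>i\<in>H. \<Sum>j\<in>H. D i j) \<le> 9 * q * (\<Sum>i\<in>H. D i i)"
        if H: "H \<subseteq> {..<n}" "real (card H) * q \<le> real n" for H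
      proof -
        have fin: "finite H" using H(1) by (rule finite_subset) simp
        \<comment> \<open>Strictly above the average degree bound \<open>8 * q\<close>, and at most
          \<open>9 * q\<close> since \<open>1 \<le> q\<close>.\<close>
        define k where "k = nat \<lfloor>8 * q\<rfloor> + 1"
        have k: "8 * q < real k" "real k \<le> 9 * q"
        proof -
          have "real (nat \<lfloor>8 * q\<rfloor>) = of_int \<lfloor>8 * q\<rfloor>" using q by simp
          then show "8 * q < real k" "real k \<le> 9 * q"
            using q floor_correct[of "8 * q"] unfolding k_def by linarith+
        qed
        have "\<exists>f. (\<forall>i\<in>H. f i < k) \<and> (\<forall>i\<in>H. \<forall>j\<in>H. {i, j} \<in> E \<longrightarrow> f i \<noteq> f j)"
        proof (rule degenerate_coloring[OF E H(1) k(1)])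
          fix H' assume H': "H' \<subseteq> H" "H' \<noteq> {}"
          have "real (card H') * q \<le> real (card H) * q"
            using H' fin q by (intro mult_right_mono of_nat_mono card_mono) auto
          then have "real (card H') * q \<le> real n" using H(2) by simp
          moreover have "H' \<subseteq> {..<n}" using H' H by blast
          ultimately have "real (card (induced_edges E H')) \<le> 4 * q * real (card H')"
            using sparse H'(2) unfolding locally_sparse_def q_def by blast
          then show "2 * real (card (induced_edges E H')) \<le> 8 * q * real (card H')" by simp
        qed
        then obtain f where f: "\<And>i. i \<in> H \<Longrightarrow> f i < k"
          "\<And>i j. i \<in> H \<Longrightarrow> j \<in> H \<Longrightarrow> {i, j} \<in> E \<Longrightarrow> f i \<noteq> f j" by blast
        have "(\<Sum>i\<in>H. \<Sum>j\<in>H. D i j) \<le> real k * (\<Sum>i\<in>H. D i i)"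
        proof (rule psd_sum_le_coloring[OF D H(1) f(1)])
          fix i j assume ij: "i \<in> H" "j \<in> H" "i \<noteq> j" "f i = f j"
          then show "D i j \<le> 0" using f(2)[of i j] H(1) by (intro D0) auto
        qed
        also have "\<dots> \<le> 9 * q * (\<Sum>i\<in>H. D i i)"
          using k psd_diag_nonneg[OF D] H by (intro mult_right_mono sum_nonneg) auto
        finally show ?thesis .
      qed
    qed (use q in auto)
  qed
  then show ?thesis by (simp add: q_def)
qed

lemma two_le_if_mean_degree_ge_1:
  assumes "p \<le> 1 / 2" "1 \<le> real n * p"
  shows "2 \<le> n"
proof (rule ccontr)
  assume "\<not> 2 \<le> n"
  then have "real n \<le> 1" by simp
  moreover have "real n * p \<le> real n * (1 / 2)" using assms(1) by (intro mult_left_mono) auto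
  ultimately show False using assms(2) by linarith
qed

text \<open>The lower bound is dual to \<open>theta_2_le\<close>, which rests on
  \<open>bounded_form\<close> alone; hence the failure probability \<open>exp (- n)\<close>.\<close>

lemma theta_bar_chain:
  assumes bd: "bounded_form n p E" and p: "0 < p" "p \<le> 1 / 2" and np: "1 \<le> real n * p"
    and E: "E \<subseteq> all_pairs n"
  shows "1 / 5764 * sqrt (real n * p) \<le> theta_bar_half n E \<and>
     theta_bar_half n E \<le> theta_bar n E \<and> theta_bar n E \<le> theta_bar_2 n E"
proof -
  have n: "2 \<le> n" by (rule two_le_if_mean_degree_ge_1[OF p(2) np])
  have "real n / (5764 * sqrt (real n / p)) \<le> theta_bar_half n E"
    using theta_2_le[OF bd p np E] by (intro theta_bar_half_ge[OF n E]) (simp add: theta_2_def)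
  moreover have "real n / (5764 * sqrt (real n / p)) = 1 / 5764 * sqrt (real n * p)"
    using n p by (simp add: real_sqrt_divide real_sqrt_mult field_simps)
  ultimately show ?thesis
    using theta_bar_half_le_theta_bar[OF n E] theta_bar_le_theta_bar_2[OF n E] by simp
qed

lemma theta_chain:
  assumes bd: "bounded_form n p E" and sparse: "locally_sparse n p E"
    and p: "0 < p" "p \<le> 1 / 2" and np: "1 \<le> real n * p" and E: "E \<subseteq> all_pairs n"
  shows "1 / 11540 * sqrt (real n / p) \<le> theta_half n E \<and>
     theta_half n E \<le> theta n E \<and> theta n E \<le> theta_2 n E"
proof -
  have n: "2 \<le> n" by (rule two_le_if_mean_degree_ge_1[OF p(2) np])
  have C: "compl_graph n E \<subseteq> all_pairs n" by (auto simp: compl_graph_def)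
  have "real n / (11540 * sqrt (real n * p)) \<le> theta_half n E"
    unfolding theta_half_def using theta_bar_2_le[OF bd sparse p np E]
    by (intro theta_bar_half_ge[OF n C]) (simp add: compl_compl_graph[OF E])
  moreover have "real n / (11540 * sqrt (real n * p)) = 1 / 11540 * sqrt (real n / p)"
    using n p by (simp add: real_sqrt_divide real_sqrt_mult field_simps)
  ultimately show ?thesis
    using theta_bar_half_le_theta_bar[OF n C] theta_bar_le_theta_bar_2[OF n C]
    by (simp add: theta_half_def theta_def theta_2_def)
qed

lemma prob_not_bounded_form:
  assumes "0 \<le> p" "p \<le> 1" "1 \<le> real n * p"
  shows "gnp_prob n p (\<lambda>E. \<not> bounded_form n p E) \<le> exp (- real n)"
  using centered_form_bounded_box[OF assms(1,2) refl assms(3)]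
  unfolding bounded_form_def by (simp add: not_le conj_assoc)

lemma prob_not_locally_sparse:
  assumes "0 \<le> p" "p \<le> 1" "1 \<le> real n * p"
  shows "gnp_prob n p (\<lambda>E. \<not> locally_sparse n p E) \<le> 1 / real n"
  using sparse_subgraphs[OF assms(1,2) refl assms(3)]
  unfolding locally_sparse_def by (simp add: not_le conj_assoc)

theorem theorem4:
  "\<exists>c0 > 0. \<exists>c1 > 0. \<exists>c2 > 0. \<exists>c3 > 0. \<exists>c4 > 0.
     \<forall>p :: nat \<Rightarrow> real.
       (\<forall>\<^sub>F n in sequentially. c0 / real n \<le> p n \<and> p n \<le> 1 / 2) \<longrightarrow>
       ((\<lambda>n. gnp_prob n (p n) (\<lambda>E.
            c1 * sqrt (real n / p n) \<le> theta_half n E \<and>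
            theta_half n E \<le> theta n E \<and>
            theta n E \<le> theta_2 n E \<and>
            theta_2 n E \<le> c2 * sqrt (real n / p n) \<and>
            c3 * sqrt (real n * p n) \<le> theta_bar_half n E \<and>
            theta_bar_half n E \<le> theta_bar n E \<and>
            theta_bar n E \<le> theta_bar_2 n E \<and>
            theta_bar_2 n E \<le> c4 * sqrt (real n * p n))) \<longlonglongrightarrow> 1) \<and>
       (\<forall>\<^sub>F n in sequentially. gnp_prob n (p n) (\<lambda>E.
            c3 * sqrt (real n * p n) \<le> theta_bar_half n E \<and>
            theta_bar_half n E \<le> theta_bar n E \<and>
            theta_bar n E \<le> theta_bar_2 n E) \<ge> 1 - exp (- real n))"
proof -
  define all where "all = (\<lambda>n p E.
      1 / 11540 * sqrt (real n / p) \<le> theta_half n E \<and>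
      theta_half n E \<le> theta n E \<and>
      theta n E \<le> theta_2 n E \<and>
      theta_2 n E \<le> 5764 * sqrt (real n / p) \<and>
      1 / 5764 * sqrt (real n * p) \<le> theta_bar_half n E \<and>
      theta_bar_half n E \<le> theta_bar n E \<and>
      theta_bar n E \<le> theta_bar_2 n E \<and>
      theta_bar_2 n E \<le> 11540 * sqrt (real n * p))"
  define lower where "lower = (\<lambda>n p E.
      1 / 5764 * sqrt (real n * p) \<le> theta_bar_half n E \<and>
      theta_bar_half n E \<le> theta_bar n E \<and>
      theta_bar n E \<le> theta_bar_2 n E)"
  have all_prob: "1 - (exp (- real n) + 1 / real n) \<le> gnp_prob n p (all n p)"
    and lower_prob: "1 - exp (- real n) \<le> gnp_prob n p (lower n p)"
    if p: "0 < p" "p \<le> 1 / 2" "1 \<le> real n * p" for n p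
  proof -
    have p01: "0 \<le> p" "p \<le> 1" using p by auto
    have "gnp_prob n p (\<lambda>E. \<not> bounded_form n p E \<or> \<not> locally_sparse n p E) \<le> exp (- real n) + 1 / real n"
      using gnp_prob_disj[OF p01, of n "\<lambda>E. \<not> bounded_form n p E" "\<lambda>E. \<not> locally_sparse n p E"]
        prob_not_bounded_form[OF p01 p(3)] prob_not_locally_sparse[OF p01 p(3)] by simp
    then have "1 - (exp (- real n) + 1 / real n)
        \<le> gnp_prob n p (\<lambda>E. \<not> (\<not> bounded_form n p E \<or> \<not> locally_sparse n p E))"
      by (subst gnp_prob_not) simp
    also have "\<dots> \<le> gnp_prob n p (all n p)"
    proof (rule gnp_prob_mono[OF p01])
      fix E assume E: "E \<subseteq> all_pairs n" and "\<not> (\<not> bounded_form n p E \<or> \<not> locally_sparse n p E)"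
      then have ev: "bounded_form n p E" "locally_sparse n p E" by auto
      show "all n p E"
        unfolding all_def
        using theta_chain[OF ev p E] theta_bar_chain[OF ev(1) p E] theta_2_le[OF ev(1) p E]
          theta_bar_2_le[OF ev p E] by blast
    qed
    finally show "1 - (exp (- real n) + 1 / real n) \<le> gnp_prob n p (all n p)" .
    have "1 - exp (- real n) \<le> gnp_prob n p (\<lambda>E. \<not> \<not> bounded_form n p E)"
      using prob_not_bounded_form[OF p01 p(3)] by (subst gnp_prob_not) simp
    also have "\<dots> \<le> gnp_prob n p (lower n p)"
      unfolding lower_def using theta_bar_chain[OF _ p] by (intro gnp_prob_mono[OF p01]) blast
    finally show "1 - exp (- real n) \<le> gnp_prob n p (lower n p)" .
  qed
  have main: "((\<lambda>n. gnp_prob n (p n) (all n (p n))) \<longlonglongrightarrow> 1) \<and>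
      (\<forall>\<^sub>F n in sequentially. 1 - exp (- real n) \<le> gnp_prob n (p n) (lower n (p n)))"
    if ev: "\<forall>\<^sub>F n in sequentially. 1 / real n \<le> p n \<and> p n \<le> 1 / 2" for p
  proof -
    have ev': "\<forall>\<^sub>F n in sequentially. 0 < p n \<and> p n \<le> 1 / 2 \<and> 1 \<le> real n * p n"
      using ev eventually_gt_at_top[of 0]
    proof eventually_elim
      case (elim n)
      then have "0 < 1 / real n" "1 \<le> real n * p n" by (simp_all add: field_simps)
      with elim show ?case by linarith
    qed
    have "(\<lambda>n. gnp_prob n (p n) (all n (p n))) \<longlonglongrightarrow> 1"
    proof (rule tendsto_sandwich[of "\<lambda>n. 1 - (exp (- real n) + 1 / real n)" _ _ "\<lambda>_. 1"])
      show "\<forall>\<^sub>F n in sequentially. 1 - (exp (- real n) + 1 / real n) \<le> gnp_prob n (p n) (all n (p n))"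
        using ev' by eventually_elim (auto intro: all_prob)
      show "\<forall>\<^sub>F n in sequentially. gnp_prob n (p n) (all n (p n)) \<le> 1"
        using ev' by eventually_elim (auto intro: gnp_prob_le_1)
      have "(\<lambda>n. 1 - (exp (- real n) + 1 / real n)) \<longlonglongrightarrow> 1 - (0 + 0)"
        by (intro tendsto_intros lim_1_over_n filterlim_compose[OF exp_at_bot]
            filterlim_uminus_at_bot[THEN iffD2])
           (simp add: filterlim_real_sequentially)
      then show "(\<lambda>n. 1 - (exp (- real n) + 1 / real n)) \<longlonglongrightarrow> 1" by simp
    qed simp
    moreover have "\<forall>\<^sub>F n in sequentially. 1 - exp (- real n) \<le> gnp_prob n (p n) (lower n (p n))"
      using ev' by eventually_elim (auto intro: lower_prob)
    ultimately show ?thesis ..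
  qed
  show ?thesis
    \<comment> \<open>\<open>c0 = 1\<close> guarantees mean degree at least 1; \<open>c1\<close> and
      \<open>c3\<close> are the reciprocals of \<open>c4\<close> and \<open>c2\<close>.\<close>
    apply (rule exI[of _ 1], rule conjI, simp)
    apply (rule exI[of _ "1 / 11540"], rule conjI, simp)
    apply (rule exI[of _ 5764], rule conjI, simp)
    apply (rule exI[of _ "1 / 5764"], rule conjI, simp)
    apply (rule exI[of _ 11540], rule conjI, simp)
    using main unfolding all_def lower_def by blast
qed

end
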